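(* There exist a Borel function $G:S\to[0,\infty)$, a centered probability distribution $\nu$ on $\mathbb{R}$ with all moments finite and $\mathbf{S}(G)<\infty$, and randomized stopping times $\xi^1,\xi^2\in\mathcal{R}(\nu)$ which are equivalent (mutually absolutely continuous) as measures on $S$, such that $\xi^1$ is optimal for $\mathbf{S}(G)$ (i.e. $\xi^1(G)=\mathbf{S}(G)$) and $\xi^2$ is not optimal for $\mathbf{S}(G)$.
   Context: $C_0(\mathbb{R}_+)$ is the set of continuous $\omega:\mathbb{R}_+\to\mathbb{R}$ with $\omega_0=0$, with Wiener measure $\mathbb{W}$, coordinate process $B_t(\omega)=\omega_t$ and raw canonical filtration $\mathcal{F}_t=\sigma(B_s,\,s\le t)$. $S$ is the space of stopped paths: pairs $(\omega,t)$ with $t\in\mathbb{R}_+$ and $\omega:[0,t]\to\mathbb{R}$ continuous, $\omega_0=0$, with the (Polish) metric $d((f,s),(g,t))=|t-s|\vee\sup_{u\ge0}|f_{u\wedge s}-g_{u\wedge t}|$. A function $G$ on $S$ is viewed as a function $G(\omega|_{[0,t]},t)$ on $C_0(\mathbb{R}_+)\times\mathbb{R}_+$. A randomized stopping time is a probability measure $\xi$ on $C_0(\mathbb{R}_+)\times\mathbb{R}_+$ with disintegration $\xi(d\omega,dt)=\mathbb{W}(d\omega)\,\xi_\omega(dt)$ such that $\xi_\omega(\mathbb{R}_+)=1$ for almost all $\omega$ and $\omega\mapsto\xi_\omega([0,t])$ is $\mathcal{F}_t$-measurable for all $t\ge0$. It induces a measure on $S$ as its image under $(\omega,t)\mapsto(\omega|_{[0,t]},t)$.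 With $\boldsymbol{t}(\omega,t)=t$ and $B(\omega,t)=\omega_t$, $\mathcal{R}(\nu)$ is the set of randomized stopping times $\xi$ with $\int\boldsymbol{t}\,d\xi<\infty$ and $\xi\circ B^{-1}=\nu$. $\mathbf{S}(G)=\sup_{\xi\in\mathcal{R}(\nu)}\xi(G)$ with $\xi(G)=\int G\,d\xi$. *)

theory Defs
  imports "HOL-Probability.Probability"
begin

section \<open>Path space and Wiener measure\<close>

text \<open>A path on \<open>[0,\<infinity>)\<close> (or on \<open>[0,t]\<close>) is represented by its unique extensional extension to
  a function on the reals, i.e. it has the value \<^term>\<open>undefined\<close> outside its domain.\<close>

type_synonym path = "real \<Rightarrow> real"

definition C0 :: "path set" where
  "C0 = {\<omega> \<in> extensional {0..}. continuous_on {0..} \<omega> \<and> \<omega> 0 = 0}"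

definition C0_algebra :: "path measure" where
  "C0_algebra = sigma C0 {{\<omega> \<in> C0. \<omega> s \<in> A} | s A. 0 \<le> s \<and> A \<in> sets borel}"

definition raw_filtration :: "real \<Rightarrow> path measure" where
  "raw_filtration t = sigma C0 {{\<omega> \<in> C0. \<omega> s \<in> A} | s A. 0 \<le> s \<and> s \<le> t \<and> A \<in> sets borel}"

text \<open>Wiener measure is the (unique) law on \<^const>\<open>C0\<close> under which the coordinate process
  is a standard Brownian motion.\<close>

definition wiener_measure :: "path measure \<Rightarrow> bool" where
  "wiener_measure W \<longleftrightarrow>
     prob_space W \<and> space W = C0 \<and> sets W = sets C0_algebra \<and>
     (\<forall>s t. 0 \<le> s \<longrightarrow> s < t \<longrightarrow>
        distributed W lborel (\<lambda>\<omega>. \<omega> t - \<omega> s) (normal_density 0 (sqrt (t - s))) \<and>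
        prob_space.indep_set W (sets (raw_filtration s))
          (sets (vimage_algebra C0 (\<lambda>\<omega>. \<omega> t - \<omega> s) borel)))"


section \<open>Stopped paths\<close>

definition stopped_paths :: "(path \<times> real) set" where
  "stopped_paths =
     {(f, t). 0 \<le> t \<and> f \<in> extensional {0..t} \<and> continuous_on {0..t} f \<and> f 0 = 0}"

definition stopped_dist :: "path \<times> real \<Rightarrow> path \<times> real \<Rightarrow> real" where
  "stopped_dist = (\<lambda>(f, s) (g, t).
     max \<bar>t - s\<bar> (SUP u\<in>{0..}. \<bar>f (min u s) - g (min u t)\<bar>))"

lemma stopped_diff_bdd_above:
  assumes "(f, s) \<in> stopped_paths" "(g, t) \<in> stopped_paths"
  shows "bdd_above ((\<lambda>u. \<bar>f (min u s) - g (min u t)\<bar>) ` {0..})"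
proof -
  have "bounded (f ` {0..s})" "bounded (g ` {0..t})"
    using assms by (auto simp: stopped_paths_def intro!: compact_imp_bounded compact_continuous_image)
  then obtain a b where a: "\<And>x. x \<in> {0..s} \<Longrightarrow> \<bar>f x\<bar> \<le> a" and b: "\<And>x. x \<in> {0..t} \<Longrightarrow> \<bar>g x\<bar> \<le> b"
    unfolding bounded_iff by (metis image_eqI real_norm_def)
  have "\<bar>f (min u s) - g (min u t)\<bar> \<le> a + b" if "0 \<le> u" for u
    using a[of "min u s"] b[of "min u t"] that assms by (auto simp: stopped_paths_def)
  then show ?thesis by (intro bdd_aboveI[of _ "a + b"]) auto
qed

lemma Metric_space_stopped_paths: "Metric_space stopped_paths stopped_dist"
proof
  fix x y :: "path \<times> real"
  show "0 \<le> stopped_dist x y"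
    by (auto simp: stopped_dist_def split: prod.split)
  show "stopped_dist x y = stopped_dist y x"
    by (auto simp: stopped_dist_def abs_minus_commute split: prod.split)
next
  fix x y :: "path \<times> real"
  assume x: "x \<in> stopped_paths" and y: "y \<in> stopped_paths"
  obtain f s g t where xy: "x = (f, s)" "y = (g, t)" by fastforce
  have bdd: "bdd_above ((\<lambda>u. \<bar>f (min u s) - g (min u t)\<bar>) ` {0..})"
    using x y unfolding xy by (rule stopped_diff_bdd_above)
  show "stopped_dist x y = 0 \<longleftrightarrow> x = y"
  proof
    assume 0: "stopped_dist x y = 0"
    then have st: "s = t" by (auto simp: stopped_dist_def xy max_def split: if_splits)
    have "f u = g u" if "u \<in> {0..s}" for u
    proof -
      have "\<bar>f (min u s) - g (min u t)\<bar> \<le> (SUP u\<in>{0..}. \<bar>f (min u s) - g (min u t)\<bar>)"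
        using that by (intro cSUP_upper bdd) auto
      also have "\<dots> \<le> 0" using 0 by (auto simp: stopped_dist_def xy max_def split: if_splits)
      finally show ?thesis using that st by (auto simp: min_def split: if_splits)
    qed
    then have "f = g"
      using x y by (intro extensionalityI[of f "{0..s}" g]) (auto simp: xy st stopped_paths_def)
    then show "x = y" by (simp add: xy st)
  next
    assume "x = y"
    then show "stopped_dist x y = 0" by (auto simp: stopped_dist_def xy)
  qed
next
  fix x y z :: "path \<times> real"
  assume x: "x \<in> stopped_paths" and y: "y \<in> stopped_paths" and z: "z \<in> stopped_paths"
  obtain f r g s h t where xyz: "x = (f, r)" "y = (g, s)" "z = (h, t)" by (metis surj_pair)
  let ?A = "SUP u\<in>{0..}. \<bar>f (min u r) - g (min u s)\<bar>"
  let ?B = "SUP u\<in>{0..}. \<bar>g (min u s) - h (min u t)\<bar>"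
  have "(SUP u\<in>{0..}. \<bar>f (min u r) - h (min u t)\<bar>) \<le> ?A + ?B"
  proof (rule cSUP_least)
    fix u :: real assume u: "u \<in> {0..}"
    have "\<bar>f (min u r) - g (min u s)\<bar> \<le> ?A" "\<bar>g (min u s) - h (min u t)\<bar> \<le> ?B"
      using x y z u unfolding xyz by (auto intro!: cSUP_upper stopped_diff_bdd_above)
    then show "\<bar>f (min u r) - h (min u t)\<bar> \<le> ?A + ?B" by linarith
  qed simp
  then show "stopped_dist x z \<le> stopped_dist x y + stopped_dist y z"
    unfolding xyz stopped_dist_def prod.case by linarith
qed

definition stopped_borel :: "(path \<times> real) measure" where
  "stopped_borel = sigma stopped_paths
     {U. openin (Metric_space.mtopology stopped_paths stopped_dist) U}"

definition stop_map :: "path \<times> real \<Rightarrow> path \<times> real" where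
  "stop_map = (\<lambda>(\<omega>, t). (restrict \<omega> {0..t}, t))"


section \<open>Randomized stopping times and the optimization problem\<close>

abbreviation time_borel :: "real measure" where
  "time_borel \<equiv> restrict_space borel {0..}"

text \<open>The kernel \<open>\<kappa>\<close> is the disintegration \<open>\<omega> \<mapsto> \<xi>\<^sub>\<omega>\<close> of \<open>\<xi>\<close> with respect to \<open>W\<close>; its
  adaptedness is required for every \<open>\<omega>\<close>, relative to the uncompleted filtration.\<close>

definition randomized_stopping_time :: "path measure \<Rightarrow> (path \<times> real) measure \<Rightarrow> bool" where
  "randomized_stopping_time W \<xi> \<longleftrightarrow>
     prob_space \<xi> \<and> sets \<xi> = sets (W \<Otimes>\<^sub>M time_borel) \<and>
     (\<exists>\<kappa> \<in> W \<rightarrow>\<^sub>M subprob_algebra time_borel.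
        (\<forall>X \<in> sets \<xi>. emeasure \<xi> X = (\<integral>\<^sup>+ \<omega>. emeasure (\<kappa> \<omega>) (Pair \<omega> -` X) \<partial>W)) \<and>
        (AE \<omega> in W. emeasure (\<kappa> \<omega>) {0..} = 1) \<and>
        (\<forall>t\<ge>0. (\<lambda>\<omega>. emeasure (\<kappa> \<omega>) {0..t}) \<in> borel_measurable (raw_filtration t)))"

definition stopped_law :: "(path \<times> real) measure \<Rightarrow> (path \<times> real) measure" where
  "stopped_law \<xi> = distr \<xi> stopped_borel stop_map"

definition embeddings :: "path measure \<Rightarrow> real measure \<Rightarrow> (path \<times> real) measure set" where
  "embeddings W \<nu> = {\<xi>. randomized_stopping_time W \<xi> \<and>
     (\<integral>\<^sup>+ (\<omega>, t). ennreal t \<partial>\<xi>) < \<infinity> \<and> distr \<xi> borel (\<lambda>(\<omega>, t). \<omega> t) = \<nu>}"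

definition payoff :: "(path \<times> real \<Rightarrow> real) \<Rightarrow> (path \<times> real) measure \<Rightarrow> ennreal" where
  "payoff G \<xi> = (\<integral>\<^sup>+ x. ennreal (G (stop_map x)) \<partial>\<xi>)"

definition optimal_value ::
    "path measure \<Rightarrow> real measure \<Rightarrow> (path \<times> real \<Rightarrow> real) \<Rightarrow> ennreal" where
  "optimal_value W \<nu> G = (SUP \<xi>\<in>embeddings W \<nu>. payoff G \<xi>)"

end

theory Submission
  imports Defs
begin

text \<open>
  Call the period \<open>[2k, 2k + 2]\<close> up-down if the path increases over its first half and decreases
  over its second half, and down-up in the opposite case; both have the same probability \<open>p\<close>. Let
  \<open>G\<close> be \<open>p\<^sup>-\<^sup>n\<close> at time \<open>2n\<close> if the first \<open>n\<close> periods are up-down, and 0 otherwise. At even times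
  this is a nonnegative martingale started at 1, so no stopping time earns more than 1; a stopping
  time earns less precisely when, under the change of measure with density \<open>G\<close>, it is infinite with
  positive probability.

  Toss a fair coin and follow a run of up-down, respectively down-up, periods. Stop when the run
  breaks, and otherwise survive up to time \<open>2n\<close> with probability \<open>s\<^sub>n\<close>, respectively \<open>t\<^sub>n\<close>, where
  \<open>s\<close> and \<open>t\<close> are strictly decreasing. Interchanging the two halves of every period preserves
  Wiener measure and the values at even times, so exchanging \<open>s\<close> and \<open>t\<close> does not change the law of
  the stopped process, nor does it change the null sets. But the mass that survives on the up-down run
  is lost: the payoff is \<open>1 - lim s\<^sub>n / 2\<close>. Take \<open>s\<^sub>n \<longlonglongrightarrow> 0\<close> and \<open>t\<^sub>n \<longlonglongrightarrow> 1 / 2\<close>.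
\<close>

section \<open>Gaussian pairs\<close>

definition std_gauss :: "real measure" where
  "std_gauss = density lborel std_normal_density"

text \<open>The joint law of the two increments of a Brownian path over the two halves of a period
  of length 2.\<close>

definition gauss2 :: "(real \<times> real) measure" where
  "gauss2 = std_gauss \<Otimes>\<^sub>M std_gauss"

lemma sets_std_gauss [simp, measurable_cong]: "sets std_gauss = sets borel"
  and space_std_gauss [simp]: "space std_gauss = UNIV"
  by (simp_all add: std_gauss_def)

lemma sets_gauss2 [simp, measurable_cong]: "sets gauss2 = sets borel"
  and space_gauss2 [simp]: "space gauss2 = UNIV"
  unfolding gauss2_def
  by (subst borel_prod[symmetric], rule sets_pair_measure_cong) (simp_all add: space_pair_measure)

interpretation std_gauss: prob_space std_gauss
  unfolding std_gauss_def by (rule prob_space_normal_density) simp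

interpretation gauss_pair: pair_prob_space std_gauss std_gauss ..

interpretation gauss2: prob_space gauss2
  unfolding gauss2_def by (rule gauss_pair.prob_space_axioms)

text \<open>The density is strictly positive, so a Gaussian null set is Lebesgue null, and a
  nonempty open set is not. This gives \<open>p_up\<close> > 0, without which the payoff factor
  \<open>1 / p_up\<close> would be meaningless.\<close>

lemma std_gauss_open_pos:
  assumes "open A" "A \<noteq> {}"
  shows "emeasure std_gauss A > 0"
proof -
  have A: "A \<in> sets borel" using assms by auto
  have "emeasure std_gauss A \<noteq> 0"
  proof
    assume "emeasure std_gauss A = 0"
    then have "(\<integral>\<^sup>+ x. ennreal (std_normal_density x) * indicator A x \<partial>lborel) = 0"
      using A by (simp add: std_gauss_def emeasure_density)
    then have "AE x in lborel. ennreal (std_normal_density x) * indicator A x = 0"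
      using A by (subst (asm) nn_integral_0_iff_AE) auto
    then have "AE x in lborel. x \<notin> A"
      proof eventually_elim
      case (elim x)
      then show ?case using normal_density_pos[of 1 0 x] by (auto simp: indicator_def split: if_splits)
    qed
    then have "emeasure lborel A = 0"
      using A by (subst (asm) AE_iff_measurable[of A]) auto
    then show False using open_not_negligible[OF assms] A
      by (auto simp: negligible_iff_null_sets null_sets_def)
  qed
  then show ?thesis by (simp add: zero_less_iff_neq_zero)
qed

lemma distr_std_gauss_uminus: "distr std_gauss std_gauss uminus = std_gauss"
proof -
  have "std_gauss = density (distr lborel borel uminus) std_normal_density"
    by (simp add: std_gauss_def lborel_distr_uminus)
  also have "\<dots> = distr (density lborel (\<lambda>x. std_normal_density (- x))) borel uminus"
    by (subst density_distr) auto
  also have "(\<lambda>x. std_normal_density (- x)) = std_normal_density"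
    by (auto simp: normal_density_def fun_eq_iff)
  finally show ?thesis
    by (simp add: std_gauss_def cong: distr_cong)
qed

lemma measurable_gauss2_swap [measurable]: "(\<lambda>(x, y). (y, x)) \<in> gauss2 \<rightarrow>\<^sub>M gauss2"
  and measurable_gauss2_uminus [measurable]: "(\<lambda>(x, y). (- x, - y)) \<in> gauss2 \<rightarrow>\<^sub>M gauss2"
  unfolding gauss2_def by measurable

text \<open>The swap interchanges \<open>up_down\<close> and \<open>down_up\<close> and keeps the
  sum of the coordinates, which is the displacement over the period. It is the source of the
  symmetry of the embedded law in the two survival sequences.\<close>

lemma distr_gauss2_swap: "distr gauss2 gauss2 (\<lambda>(x, y). (y, x)) = gauss2"
  unfolding gauss2_def by (rule gauss_pair.distr_pair_swap[symmetric])

text \<open>Negation also interchanges \<open>up_down\<close> and \<open>down_up\<close>, but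
  reverses the displacement. Combined with the swap it makes the embedded law symmetric about 0,
  hence centered.\<close>

lemma distr_gauss2_uminus: "distr gauss2 gauss2 (\<lambda>(x, y). (- x, - y)) = gauss2"
proof -
  have "distr std_gauss std_gauss uminus \<Otimes>\<^sub>M distr std_gauss std_gauss uminus =
      distr (std_gauss \<Otimes>\<^sub>M std_gauss) (std_gauss \<Otimes>\<^sub>M std_gauss) (\<lambda>(x, y). (- x, - y))"
    by (rule pair_measure_distr)
      (auto simp: distr_std_gauss_uminus std_gauss.sigma_finite_measure_axioms)
  then show ?thesis
    by (simp add: distr_std_gauss_uminus gauss2_def)
qed

definition up_down :: "(real \<times> real) set" where "up_down = {0<..} \<times> {..<0}"
definition down_up :: "(real \<times> real) set" where "down_up = {..<0} \<times> {0<..}"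

lemma up_down_borel [measurable]: "up_down \<in> sets borel"
  and down_up_borel [measurable]: "down_up \<in> sets borel"
  by (auto simp: up_down_def down_up_def borel_prod[symmetric])

definition p_up :: real where "p_up = measure gauss2 up_down"

lemma measure_down_up: "measure gauss2 down_up = p_up"
proof -
  have "measure gauss2 down_up = measure (distr gauss2 gauss2 (\<lambda>(x, y). (y, x))) down_up"
    by (simp add: distr_gauss2_swap)
  also have "\<dots> = measure gauss2 ((\<lambda>(x, y). (y, x)) -` down_up)"
    by (subst measure_distr) auto
  also have "(\<lambda>(x, y). (y, x)) -` down_up = up_down"
    by (auto simp: up_down_def down_up_def)
  finally show ?thesis by (simp add: p_up_def)
qed

lemma p_up_pos: "p_up > 0"
proof -
  have "emeasure gauss2 up_down = emeasure std_gauss {0<..} * emeasure std_gauss {..<0}"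
    unfolding gauss2_def up_down_def by (rule std_gauss.emeasure_pair_measure_Times) auto
  also have "\<dots> > 0"
    by (metis ennreal_zero_less_mult_iff greaterThan_non_empty lessThan_non_empty open_greaterThan
        open_lessThan std_gauss_open_pos)
  finally show ?thesis
    by (simp add: p_up_def gauss2.emeasure_eq_measure)
qed

text \<open>Two disjoint sets share the measure \<open>p_up\<close>. The consequence
  \<open>p_up\<close> < 1 makes runs end almost surely and the later series converge.\<close>

lemma p_up_le_half: "p_up \<le> 1/2"
proof -
  have "measure gauss2 (up_down \<union> down_up) = p_up + p_up"
    by (subst gauss2.finite_measure_Union)
      (auto simp: p_up_def[symmetric] measure_down_up, auto simp: up_down_def down_up_def)
  then show ?thesis using gauss2.prob_le_1[of "up_down \<union> down_up"] by simp
qed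

lemma p_up_less_1: "p_up < 1"
  using p_up_le_half by simp


section \<open>Alternating runs\<close>

definition incr :: "nat \<Rightarrow> path \<Rightarrow> real \<times> real" where
  "incr k \<omega> = (\<omega> (2 * real k + 1) - \<omega> (2 * real k), \<omega> (2 * real k + 2) - \<omega> (2 * real k + 1))"

definition run :: "(real \<times> real) set \<Rightarrow> nat \<Rightarrow> path \<Rightarrow> bool" where
  "run P n \<omega> \<longleftrightarrow> (\<forall>k<n. incr k \<omega> \<in> P)"

lemma run_0 [simp]: "run P 0 \<omega>"
  by (simp add: run_def)

lemma run_Suc: "run P (Suc n) \<omega> \<longleftrightarrow> run P n \<omega> \<and> incr n \<omega> \<in> P"
  by (auto simp: run_def less_Suc_eq)

lemma run_antimono: "run P n \<omega> \<Longrightarrow> m \<le> n \<Longrightarrow> run P m \<omega>"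
  by (auto simp: run_def)

text \<open>The first period already decides between the two kinds of run; only the empty run
  belongs to both.\<close>

lemma run_up_down_down_up: "run up_down (Suc n) \<omega> \<Longrightarrow> run down_up m \<omega> \<Longrightarrow> m = 0"
  by (cases m) (force simp: run_def up_down_def down_up_def)+

lemma space_raw_filtration [simp]: "space (raw_filtration t) = C0"
  by (simp add: raw_filtration_def space_measure_of_conv)

lemma space_C0_algebra [simp]: "space C0_algebra = C0"
  by (simp add: C0_algebra_def space_measure_of_conv)

lemma measurable_eval_raw [measurable (raw)]:
  assumes "0 \<le> u" "u \<le> s"
  shows "(\<lambda>\<omega>. \<omega> u) \<in> borel_measurable (raw_filtration s)"
proof (rule measurableI)
  fix A :: "real set" assume "A \<in> sets borel"
  then have "{\<omega> \<in> C0. \<omega> u \<in> A} \<in> sets (raw_filtration s)"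
    using assms unfolding raw_filtration_def by (intro in_measure_of) auto
  also have "{\<omega> \<in> C0. \<omega> u \<in> A} = (\<lambda>\<omega>. \<omega> u) -` A \<inter> space (raw_filtration s)"
    by auto
  finally show "(\<lambda>\<omega>. \<omega> u) -` A \<inter> space (raw_filtration s) \<in> sets (raw_filtration s)" .
qed simp

lemma measurable_incr_raw:
  assumes "2 * real k + 2 \<le> s"
  shows "incr k \<in> borel_measurable (raw_filtration s)"
  unfolding incr_def using assms by (intro borel_measurable_Pair borel_measurable_diff measurable_eval_raw) auto

lemma pred_run_raw:
  assumes "2 * real n \<le> s" and [measurable]: "P \<in> sets borel"
  shows "Measurable.pred (raw_filtration s) (run P n)"
proof -
  have [measurable]: "incr k \<in> borel_measurable (raw_filtration s)" if "k \<in> {..<n}" for k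
    using that assms by (intro measurable_incr_raw) (auto simp: less_eq_Suc_le)
  have "Measurable.pred (raw_filtration s) (\<lambda>\<omega>. \<forall>k\<in>{..<n}. incr k \<omega> \<in> P)"
    by measurable
  then show ?thesis by (simp add: run_def[abs_def])
qed

lemma sets_C0_algebra:
  "sets C0_algebra = sigma_sets C0 {{\<omega> \<in> C0. \<omega> s \<in> A} | s A. 0 \<le> s \<and> A \<in> sets borel}"
  unfolding C0_algebra_def by (rule sets_measure_of) auto

lemma sets_raw_filtration:
  "sets (raw_filtration t) =
    sigma_sets C0 {{\<omega> \<in> C0. \<omega> s \<in> A} | s A. 0 \<le> s \<and> s \<le> t \<and> A \<in> sets borel}"
  unfolding raw_filtration_def by (rule sets_measure_of) auto

lemma sets_raw_filtration_subset: "sets (raw_filtration s) \<subseteq> sets C0_algebra"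
  unfolding sets_C0_algebra sets_raw_filtration by (rule sigma_sets_mono') blast

lemma sets_raw_filtration_mono: "s \<le> t \<Longrightarrow> sets (raw_filtration s) \<subseteq> sets (raw_filtration t)"
  unfolding sets_raw_filtration by (rule sigma_sets_mono') (blast intro: order.trans)

lemma measurable_id_raw_filtration: "s \<le> t \<Longrightarrow> (\<lambda>\<omega>. \<omega>) \<in> raw_filtration t \<rightarrow>\<^sub>M raw_filtration s"
  using sets_raw_filtration_mono[of s t] by (auto intro!: measurableI simp: Int_absorb2 dest: sets.sets_into_space)


section \<open>Stopping weights along a run\<close>

text \<open>Positivity and strict decrease make stopping possible at the end of every period reached
  by a run, whether the run breaks there or goes on. The limit is left free: it is the quantity that
  separates the two payoffs.\<close>

definition survival :: "(nat \<Rightarrow> real) \<Rightarrow> bool" where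
  "survival s \<longleftrightarrow> s 0 = 1 \<and> (\<forall>n. 0 < s n \<and> s (Suc n) < s n)"

lemma survival_le_1: "survival s \<Longrightarrow> s n \<le> 1"
  by (induction n) (auto simp: survival_def intro: order.trans less_imp_le)

text \<open>Probability of stopping at time \<open>2n + 2\<close> under the rule that follows a \<open>P\<close>-run, stops when the
  run breaks, and otherwise survives up to time \<open>2n\<close> with probability \<open>s n\<close>.\<close>

definition run_weight :: "(real \<times> real) set \<Rightarrow> (nat \<Rightarrow> real) \<Rightarrow> nat \<Rightarrow> path \<Rightarrow> real" where
  "run_weight P s n \<omega> =
     (if run P n \<omega> then s n - (if incr n \<omega> \<in> P then s (Suc n) else 0) else 0)"

definition mixed_weight :: "(nat \<Rightarrow> real) \<Rightarrow> (nat \<Rightarrow> real) \<Rightarrow> nat \<Rightarrow> path \<Rightarrow> real" where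
  "mixed_weight s t n \<omega> = (run_weight up_down s n \<omega> + run_weight down_up t n \<omega>) / 2"

lemma run_weight_nonneg: "survival s \<Longrightarrow> 0 \<le> run_weight P s n \<omega>"
  by (auto simp: run_weight_def survival_def intro: less_imp_le)

lemma run_weight_le:
  assumes "survival s"
  shows "run_weight P s n \<omega> \<le> of_bool (run P n \<omega>)"
proof -
  have "s n \<le> 1" "0 < s (Suc n)"
    using assms survival_le_1[OF assms] by (auto simp: survival_def)
  then show ?thesis by (auto simp: run_weight_def)
qed

lemma run_weight_eq_0_iff: "survival s \<Longrightarrow> run_weight P s n \<omega> = 0 \<longleftrightarrow> \<not> run P n \<omega>"
  by (auto simp: run_weight_def survival_def less_imp_neq) (metis less_irrefl)+

lemma mixed_weight_nonneg: "survival s \<Longrightarrow> survival t \<Longrightarrow> 0 \<le> mixed_weight s t n \<omega>"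
  by (simp add: mixed_weight_def run_weight_nonneg)

text \<open>The right-hand side mentions neither \<open>s\<close> nor \<open>t\<close>. This is why
  all these stopping rules have the same null sets.\<close>

lemma mixed_weight_eq_0_iff:
  assumes "survival s" "survival t"
  shows "mixed_weight s t n \<omega> = 0 \<longleftrightarrow> \<not> run up_down n \<omega> \<and> \<not> run down_up n \<omega>"
  using assms
  by (simp add: mixed_weight_def add_nonneg_eq_0_iff run_weight_nonneg run_weight_eq_0_iff)

text \<open>Telescoping: the differences of \<open>s\<close> accumulate while the run lasts, the
  breaking period releases all remaining mass, and later weights vanish.\<close>

lemma sum_run_weight: "(\<Sum>n<N. run_weight P s n \<omega>) = s 0 - (if run P N \<omega> then s N else 0)"
  by (induction N) (auto simp: run_weight_def run_Suc)

lemma sum_mixed_weight: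
  assumes "survival s" "survival t"
  shows "(\<Sum>n<N. mixed_weight s t n \<omega>) =
    1 - ((if run up_down N \<omega> then s N else 0) + (if run down_up N \<omega> then t N else 0)) / 2"
  using assms
  by (simp add: mixed_weight_def sum.distrib sum_run_weight survival_def diff_divide_distrib
      add_divide_distrib flip: sum_divide_distrib)

lemma measurable_run_weight_raw:
  assumes [measurable]: "P \<in> sets borel"
  shows "run_weight P s n \<in> borel_measurable (raw_filtration (2 * real n + 2))"
proof -
  have [measurable]: "Measurable.pred (raw_filtration (2 * real n + 2)) (run P n)"
    by (rule pred_run_raw) simp_all
  have [measurable]: "incr n \<in> borel_measurable (raw_filtration (2 * real n + 2))"
    by (rule measurable_incr_raw) simp
  show ?thesis unfolding run_weight_def by measurable
qed

lemma measurable_mixed_weight_raw: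
  "mixed_weight s t n \<in> borel_measurable (raw_filtration (2 * real n + 2))"
  unfolding mixed_weight_def
  by (intro borel_measurable_divide borel_measurable_add measurable_run_weight_raw) auto


section \<open>The payoff\<close>

text \<open>At even times this is the likelihood ratio of the law that conditions every period to be
  up-down. Flooring recovers the number of periods, and the guard on \<open>t\<close> discards all
  other times.\<close>

definition run_payoff :: "path \<times> real \<Rightarrow> real" where
  "run_payoff = (\<lambda>(f, t). let n = nat \<lfloor>t / 2\<rfloor> in
     if t = 2 * real n \<and> run up_down n f then (1 / p_up) ^ n else 0)"

lemma run_payoff_nonneg: "0 \<le> run_payoff x"
  using p_up_pos by (simp add: run_payoff_def Let_def split: prod.split)

lemma run_restrict: "run P n (restrict \<omega> {0..2 * real n}) \<longleftrightarrow> run P n \<omega>"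
proof -
  have "incr k (restrict \<omega> {0..2 * real n}) = incr k \<omega>" if "k < n" for k
    using that by (auto simp: incr_def restrict_def)
  then show ?thesis by (simp add: run_def)
qed

lemma run_payoff_stop_map_even:
  "run_payoff (stop_map (\<omega>, 2 * real n)) = (if run up_down n \<omega> then (1 / p_up) ^ n else 0)"
  by (simp add: run_payoff_def stop_map_def run_restrict)

lemma run_payoff_stop_map_not_even:
  "(\<And>n. t \<noteq> 2 * real n) \<Longrightarrow> run_payoff (stop_map (\<omega>, t)) = 0"
  by (simp add: run_payoff_def stop_map_def Let_def)

text \<open>At most one term is nonzero. As a series of indicators of measurable rectangles, the
  payoff is visibly measurable on the product space and can be integrated term by term.\<close>

lemma run_payoff_stop_map_eq_suminf:
  assumes "\<omega> \<in> C0"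
  shows "ennreal (run_payoff (stop_map (\<omega>, t))) =
    (\<Sum>n. ennreal ((1 / p_up) ^ n) * indicator ({\<omega> \<in> C0. run up_down n \<omega>} \<times> {2 * real n}) (\<omega>, t))"
    (is "_ = (\<Sum>n. ?f n)")
proof (cases "\<exists>n. t = 2 * real n")
  case True
  then obtain n where t: "t = 2 * real n" ..
  have "(\<Sum>k. ?f k) = (\<Sum>k\<in>{n}. ?f k)"
    by (rule suminf_finite) (auto simp: t)
  then show ?thesis using assms by (simp add: t run_payoff_stop_map_even indicator_def)
next
  case False
  then show ?thesis by (auto simp: run_payoff_stop_map_not_even)
qed

section \<open>Borel measurability on the space of stopped paths\<close>

lemma space_stopped_borel [simp]: "space stopped_borel = stopped_paths"
  by (simp add: stopped_borel_def space_measure_of_conv)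

text \<open>For a 1-Lipschitz function the ball of radius \<open>a - F x\<close> around
  \<open>x\<close> stays inside the sublevel set, which is therefore open.\<close>

lemma borel_measurable_stopped_lipschitz:
  fixes F :: "path \<times> real \<Rightarrow> real"
  assumes F: "\<And>x y. x \<in> stopped_paths \<Longrightarrow> y \<in> stopped_paths \<Longrightarrow> \<bar>F x - F y\<bar> \<le> stopped_dist x y"
  shows "F \<in> borel_measurable stopped_borel"
proof (rule borel_measurableI_less)
  interpret Metric_space stopped_paths stopped_dist by (rule Metric_space_stopped_paths)
  fix a
  have "openin mtopology {x \<in> stopped_paths. F x < a}"
    unfolding openin_mtopology
  proof safe
    fix f t assume x: "(f, t) \<in> stopped_paths" "F (f, t) < a"
    have "mball (f, t) (a - F (f, t)) \<subseteq> {x \<in> stopped_paths. F x < a}"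
      using F[OF x(1)] by (force simp: in_mball)
    then show "\<exists>r>0. mball (f, t) r \<subseteq> {x \<in> stopped_paths. F x < a}"
      using x(2) by (intro exI[of _ "a - F (f, t)"]) simp
  qed
  moreover have "{U. openin mtopology U} \<subseteq> Pow stopped_paths"
    using openin_subset topspace_mtopology by blast
  ultimately show "{x \<in> space stopped_borel. F x < a} \<in> sets stopped_borel"
    unfolding space_stopped_borel stopped_borel_def by (intro in_measure_of) auto
qed

lemma measurable_stopped_time: "snd \<in> borel_measurable stopped_borel"
  by (rule borel_measurable_stopped_lipschitz) (auto simp: stopped_dist_def abs_minus_commute)

text \<open>The difference of two such evaluations is one of the terms of the supremum in
  \<open>stopped_dist\<close>. The time is clipped because a stopped path carries no information
  after its end.\<close>

lemma measurable_stopped_eval: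
  assumes "0 \<le> u"
  shows "(\<lambda>x. fst x (min u (snd x))) \<in> borel_measurable stopped_borel"
proof (rule borel_measurable_stopped_lipschitz)
  fix x y assume xy: "x \<in> stopped_paths" "y \<in> stopped_paths"
  obtain f s g t where eq: "x = (f, s)" "y = (g, t)" by fastforce
  have "\<bar>f (min u s) - g (min u t)\<bar> \<le> (SUP u\<in>{0..}. \<bar>f (min u s) - g (min u t)\<bar>)"
    using xy assms unfolding eq by (intro cSUP_upper stopped_diff_bdd_above) auto
  then show "\<bar>fst x (min u (snd x)) - fst y (min u (snd y))\<bar> \<le> stopped_dist x y"
    by (simp add: eq stopped_dist_def)
qed

lemma measurable_run_payoff: "run_payoff \<in> borel_measurable stopped_borel"
proof -
  note [measurable] = measurable_stopped_time
  let ?E = "\<lambda>u x :: path \<times> real. fst x (min u (snd x))"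
  \<comment> \<open>The period increments with clipped evaluation times. When the path ends at time
    2n, clipping does not affect the first n periods, so there \<open>Z k\<close> agrees with
    \<open>incr k\<close>.\<close>
  define Z where "Z k x = (?E (2 * real k + 1) x - ?E (2 * real k) x,
      ?E (2 * real k + 2) x - ?E (2 * real k + 1) x)" for k x
  define g where "g n x =
    (if snd x = 2 * real n \<and> (\<forall>k\<in>{..<n}. Z k x \<in> up_down) then (1 / p_up) ^ n else 0)" for n x
  have [measurable]: "Z k \<in> borel_measurable stopped_borel" for k
    unfolding Z_def[abs_def]
    by (intro borel_measurable_Pair borel_measurable_diff measurable_stopped_eval) auto
  have "(\<lambda>x. g (nat \<lfloor>snd x / 2\<rfloor>) x) \<in> borel_measurable stopped_borel"
  proof (rule measurable_compose_countable)
    show "g n \<in> borel_measurable stopped_borel" for n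
      unfolding g_def[abs_def] by measurable
    show "(\<lambda>x. nat \<lfloor>snd x / 2\<rfloor>) \<in> stopped_borel \<rightarrow>\<^sub>M count_space UNIV"
      by measurable
  qed
  moreover have "run_payoff x = g (nat \<lfloor>snd x / 2\<rfloor>) x" for x
  proof -
    define n where "n = nat \<lfloor>snd x / 2\<rfloor>"
    have "Z k x = incr k (fst x)" if "snd x = 2 * real n" "k < n" for k
      using that by (simp add: Z_def incr_def min_def)
    then show ?thesis
      by (auto simp: run_payoff_def g_def run_def Let_def case_prod_beta simp flip: n_def)
  qed
  ultimately show ?thesis by (simp cong: measurable_cong)
qed

lemma stop_map_in_stopped_paths:
  assumes "\<omega> \<in> C0" "0 \<le> t"
  shows "stop_map (\<omega>, t) \<in> stopped_paths"
proof -
  have "continuous_on {0..t} \<omega>"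
    using assms by (auto simp: C0_def intro: continuous_on_subset)
  then have "continuous_on {0..t} (restrict \<omega> {0..t})"
    by (rule continuous_on_eq) simp
  then show ?thesis
    using assms by (auto simp: stop_map_def stopped_paths_def C0_def)
qed

text \<open>No measurability of \<open>f\<close> is assumed: a push-forward of a nonzero measure along a
  non-measurable map fails additivity, and \<^const>\<open>distr\<close> is then the zero measure.\<close>

lemma absolutely_continuous_distr:
  assumes ac: "absolutely_continuous M M'" and sets: "sets M' = sets M"
    and f: "f \<in> space M \<rightarrow> space N" and nz: "emeasure M' (space M') \<noteq> 0"
  shows "absolutely_continuous (distr M N f) (distr M' N f)"
proof (cases "f \<in> M \<rightarrow>\<^sub>M N")
  case True
  then have f': "f \<in> M' \<rightarrow>\<^sub>M N" using sets by (simp cong: measurable_cong_sets)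
  have sp: "space M' = space M" using sets by (rule sets_eq_imp_space_eq)
  show ?thesis
    unfolding absolutely_continuous_def
  proof
    fix A assume "A \<in> null_sets (distr M N f)"
    then have A: "A \<in> sets N" and "f -` A \<inter> space M \<in> null_sets M"
      using True by (auto simp: null_sets_def emeasure_distr measurable_sets)
    then have "f -` A \<inter> space M \<in> null_sets M'" using ac by (auto simp: absolutely_continuous_def)
    then show "A \<in> null_sets (distr M' N f)"
      using A f' by (auto simp: null_sets_def emeasure_distr sp)
  qed
next
  case False
  have sp: "space M' = space M" using sets by (rule sets_eq_imp_space_eq)
  let ?\<mu> = "\<lambda>A. emeasure M' (f -` A \<inter> space M')"
  obtain A where A: "A \<in> sets N" and nA: "f -` A \<inter> space M \<notin> sets M"
    using False f by (auto simp: measurable_def)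
  have "\<not> measure_space (space N) (sets N) ?\<mu>"
  proof
    assume "measure_space (space N) (sets N) ?\<mu>"
    then have "additive (sets N) ?\<mu>"
      unfolding measure_space_def by (blast intro: sets.countably_additive_additive)
    then have "?\<mu> (A \<union> (space N - A)) = ?\<mu> A + ?\<mu> (space N - A)"
      by (rule additiveD) (use A in auto)
    \<comment> \<open>\<open>emeasure\<close> takes the default value 0 outside the sigma-algebra.
      Both \<open>A\<close> and its complement have non-measurable preimages, so both get 0,
      although together they carry the whole mass.\<close>
    moreover have "?\<mu> A = 0"
      using nA by (intro emeasure_notin_sets) (simp add: sets sp)
    moreover have "?\<mu> (space N - A) = 0"
    proof (rule emeasure_notin_sets, rule notI)
      assume "f -` (space N - A) \<inter> space M' \<in> sets M'"
      then have "space M - (f -` (space N - A) \<inter> space M) \<in> sets M"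
        by (auto simp: sets sp)
      also have "space M - (f -` (space N - A) \<inter> space M) = f -` A \<inter> space M"
        using f by auto
      finally show False using nA by simp
    qed
    moreover have "f -` (A \<union> (space N - A)) \<inter> space M' = space M'"
      using f by (auto simp: sp)
    ultimately show False using nz by simp
  qed
  then have "emeasure (distr M' N f) B = 0" for B
    by (simp add: distr_def emeasure_measure_of_conv sets.sigma_sets_eq)
  then show ?thesis by (auto simp: absolutely_continuous_def null_sets_def)
qed


section \<open>Brownian increments\<close>

locale wiener_space =
  fixes W :: "path measure"
  assumes wiener: "wiener_measure W"
begin

sublocale prob_space W
  using wiener by (simp add: wiener_measure_def)

lemma space_W [simp]: "space W = C0" and sets_W [measurable_cong]: "sets W = sets C0_algebra"
  using wiener by (simp_all add: wiener_measure_def)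

lemma measurable_from_raw: "f \<in> raw_filtration s \<rightarrow>\<^sub>M M \<Longrightarrow> f \<in> W \<rightarrow>\<^sub>M M"
  using sets_raw_filtration_subset[of s] by (auto simp: measurable_def sets_W)

lemma measurable_eval [measurable (raw)]: "0 \<le> u \<Longrightarrow> (\<lambda>\<omega>. \<omega> u) \<in> borel_measurable W"
  by (rule measurable_from_raw[of _ u]) simp

lemma measurable_incr [measurable (raw)]: "incr k \<in> borel_measurable W"
  by (rule measurable_from_raw[OF measurable_incr_raw[OF order_refl]])

lemma pred_run [measurable]: "P \<in> sets borel \<Longrightarrow> Measurable.pred W (run P n)"
  by (rule measurable_from_raw[OF pred_run_raw[OF order_refl]])

text \<open>Independence makes the joint law of the past up to \<open>s\<close> and the next unit
  increment a product measure, and Fubini integrates the increment out.\<close>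

lemma nn_integral_unit_increment:
  assumes s: "0 \<le> s" and f [measurable]: "f \<in> borel_measurable (raw_filtration s \<Otimes>\<^sub>M borel)"
  shows "(\<integral>\<^sup>+ \<omega>. f (\<omega>, \<omega> (s + 1) - \<omega> s) \<partial>W) = (\<integral>\<^sup>+ \<omega>. \<integral>\<^sup>+ x. f (\<omega>, x) \<partial>std_gauss \<partial>W)"
proof -
  define Y :: "path \<Rightarrow> real" where "Y = (\<lambda>\<omega>. \<omega> (s + 1) - \<omega> s)"
  have Y [measurable]: "Y \<in> borel_measurable W"
    using s by (simp add: Y_def)
  have I [measurable]: "(\<lambda>\<omega>. \<omega>) \<in> W \<rightarrow>\<^sub>M raw_filtration s"
    by (rule measurable_from_raw) (rule measurable_id_raw_filtration[OF order_refl])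
  have D: "distributed W lborel Y (normal_density 0 (sqrt (s + 1 - s)))"
    and ind: "indep_set (sets (raw_filtration s)) (sets (vimage_algebra C0 Y borel))"
    using wiener s unfolding wiener_measure_def Y_def by (meson less_add_one)+
  have "distr W (raw_filtration s) (\<lambda>\<omega>. \<omega>) \<Otimes>\<^sub>M distr W borel Y
      = distr W (raw_filtration s \<Otimes>\<^sub>M borel) (\<lambda>\<omega>. (\<omega>, Y \<omega>))"
  proof (rule pair_measure_eqI)
    show "sigma_finite_measure (distr W (raw_filtration s) (\<lambda>\<omega>. \<omega>))"
      by (intro prob_space_imp_sigma_finite prob_space_distr I)
    show "sigma_finite_measure (distr W borel Y)"
      by (intro prob_space_imp_sigma_finite prob_space_distr Y)
    fix A B assume "A \<in> sets (distr W (raw_filtration s) (\<lambda>\<omega>. \<omega>))" "B \<in> sets (distr W borel Y)"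
    then have A: "A \<in> sets (raw_filtration s)" and B: "B \<in> sets borel" by simp_all
    have AC: "A \<inter> C0 = A" using sets.sets_into_space[OF A] by auto
    have "Y -` B \<inter> C0 \<in> sets (vimage_algebra C0 Y borel)"
      using B by (auto simp: sets_vimage_algebra)
    then have "prob (A \<inter> (Y -` B \<inter> C0)) = prob A * prob (Y -` B \<inter> C0)"
      by (rule indep_setD[OF ind A])
    moreover have "(\<lambda>\<omega>. (\<omega>, Y \<omega>)) -` (A \<times> B) \<inter> C0 = A \<inter> (Y -` B \<inter> C0)"
      using AC by auto
    ultimately show "emeasure (distr W (raw_filtration s) (\<lambda>\<omega>. \<omega>)) A * emeasure (distr W borel Y) B =
        emeasure (distr W (raw_filtration s \<Otimes>\<^sub>M borel) (\<lambda>\<omega>. (\<omega>, Y \<omega>))) (A \<times> B)"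
      using A B by (simp add: emeasure_distr AC emeasure_eq_measure ennreal_mult'')
  qed simp
  moreover have "distr W borel Y = std_gauss"
    using D by (simp add: distributed_def std_gauss_def cong: distr_cong)
  ultimately have "(\<integral>\<^sup>+ \<omega>. f (\<omega>, Y \<omega>) \<partial>W)
      = (\<integral>\<^sup>+ z. f z \<partial>(distr W (raw_filtration s) (\<lambda>\<omega>. \<omega>) \<Otimes>\<^sub>M std_gauss))"
    by (simp add: nn_integral_distr)
  also have "\<dots> = (\<integral>\<^sup>+ \<omega>. \<integral>\<^sup>+ x. f (\<omega>, x) \<partial>std_gauss \<partial>distr W (raw_filtration s) (\<lambda>\<omega>. \<omega>))"
    by (rule std_gauss.nn_integral_fst[symmetric]) measurable
  also have "\<dots> = (\<integral>\<^sup>+ \<omega>. \<integral>\<^sup>+ x. f (\<omega>, x) \<partial>std_gauss \<partial>W)"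
    by (rule nn_integral_distr[OF I]) measurable
  finally show ?thesis by (simp add: Y_def)
qed

text \<open>The previous lemma is used twice: first for the second half of the period, with the
  first half counted as past, then for the first half.\<close>

lemma nn_integral_incr:
  assumes f [measurable]: "f \<in> borel_measurable (raw_filtration (2 * real n) \<Otimes>\<^sub>M borel)"
  shows "(\<integral>\<^sup>+ \<omega>. f (\<omega>, incr n \<omega>) \<partial>W) = (\<integral>\<^sup>+ \<omega>. \<integral>\<^sup>+ z. f (\<omega>, z) \<partial>gauss2 \<partial>W)"
proof -
  let ?s = "2 * real n"
  have [measurable]: "f \<in> borel_measurable (raw_filtration ?s \<Otimes>\<^sub>M (borel \<Otimes>\<^sub>M borel))"
    using f by (simp add: borel_prod)
  have [measurable]: "(\<lambda>\<omega>. \<omega>) \<in> raw_filtration (?s + 1) \<rightarrow>\<^sub>M raw_filtration ?s"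
    by (rule measurable_id_raw_filtration) simp
  have [measurable]: "(\<lambda>\<omega>. \<omega> (?s + 1) - \<omega> ?s) \<in> borel_measurable (raw_filtration (?s + 1))"
    by (intro borel_measurable_diff measurable_eval_raw) auto
  have "(\<integral>\<^sup>+ \<omega>. f (\<omega>, incr n \<omega>) \<partial>W) =
      (\<integral>\<^sup>+ \<omega>. (\<lambda>(\<omega>, v). f (\<omega>, \<omega> (?s + 1) - \<omega> ?s, v)) (\<omega>, \<omega> (?s + 1 + 1) - \<omega> (?s + 1)) \<partial>W)"
    by (simp add: incr_def add.assoc)
  also have "\<dots> = (\<integral>\<^sup>+ \<omega>. \<integral>\<^sup>+ v. f (\<omega>, \<omega> (?s + 1) - \<omega> ?s, v) \<partial>std_gauss \<partial>W)"
    by (subst nn_integral_unit_increment) auto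
  also have "\<dots> = (\<integral>\<^sup>+ \<omega>. (\<lambda>(\<omega>, u). \<integral>\<^sup>+ v. f (\<omega>, u, v) \<partial>std_gauss) (\<omega>, \<omega> (?s + 1) - \<omega> ?s) \<partial>W)"
    by simp
  also have "\<dots> = (\<integral>\<^sup>+ \<omega>. \<integral>\<^sup>+ u. \<integral>\<^sup>+ v. f (\<omega>, u, v) \<partial>std_gauss \<partial>std_gauss \<partial>W)"
    by (subst nn_integral_unit_increment) auto
  also have "\<dots> = (\<integral>\<^sup>+ \<omega>. \<integral>\<^sup>+ z. f (\<omega>, z) \<partial>gauss2 \<partial>W)"
    unfolding gauss2_def
    by (intro nn_integral_cong std_gauss.nn_integral_fst) (auto cong: measurable_cong_sets sets_pair_measure_cong)
  finally show ?thesis .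
qed

text \<open>Prolonging a run by a period costs an independent factor. The weight \<open>c\<close>,
  known at time 2n, is 1 for run probabilities and the unstopped mass in the optional stopping
  argument.\<close>

lemma nn_integral_run_Suc:
  assumes [measurable]: "P \<in> sets borel" "c \<in> borel_measurable (raw_filtration (2 * real n))"
  shows "(\<integral>\<^sup>+ \<omega>. (if run P (Suc n) \<omega> then c \<omega> else 0) \<partial>W)
    = (\<integral>\<^sup>+ \<omega>. (if run P n \<omega> then c \<omega> else 0) \<partial>W) * emeasure gauss2 P"
proof -
  have [measurable]: "Measurable.pred (raw_filtration (2 * real n)) (run P n)"
    by (rule pred_run_raw) simp_all
  have [measurable]: "c \<in> borel_measurable W" by (rule measurable_from_raw) fact
  have "(\<integral>\<^sup>+ \<omega>. (if run P (Suc n) \<omega> then c \<omega> else 0) \<partial>W) =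
      (\<integral>\<^sup>+ \<omega>. (\<lambda>(\<omega>, z). if run P n \<omega> then c \<omega> * indicator P z else 0) (\<omega>, incr n \<omega>) \<partial>W)"
    by (intro nn_integral_cong) (simp add: run_Suc)
  also have "\<dots> = (\<integral>\<^sup>+ \<omega>. \<integral>\<^sup>+ z. (if run P n \<omega> then c \<omega> * indicator P z else 0) \<partial>gauss2 \<partial>W)"
    by (subst nn_integral_incr) auto
  also have "\<dots> = (\<integral>\<^sup>+ \<omega>. (if run P n \<omega> then c \<omega> else 0) * emeasure gauss2 P \<partial>W)"
    by (intro nn_integral_cong) (simp add: nn_integral_cmult)
  also have "\<dots> = (\<integral>\<^sup>+ \<omega>. (if run P n \<omega> then c \<omega> else 0) \<partial>W) * emeasure gauss2 P"
    by (rule nn_integral_multc) measurable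
  finally show ?thesis .
qed

lemma emeasure_run:
  assumes [measurable]: "P \<in> sets borel"
  shows "emeasure W {\<omega> \<in> C0. run P n \<omega>} = ennreal (measure gauss2 P ^ n)"
proof -
  have "(\<integral>\<^sup>+ \<omega>. (if run P n \<omega> then 1 else 0) \<partial>W) = ennreal (measure gauss2 P ^ n)"
  proof (induction n)
    case 0
    then show ?case by (simp add: emeasure_space_1[simplified])
  next
    case (Suc n)
    then show ?case
      by (subst nn_integral_run_Suc) (auto simp: gauss2.emeasure_eq_measure ennreal_mult'' mult.commute)
  qed
  moreover have "(\<integral>\<^sup>+ \<omega>. (if run P n \<omega> then 1 else 0) \<partial>W)
      = (\<integral>\<^sup>+ \<omega>. indicator {\<omega> \<in> C0. run P n \<omega>} \<omega> \<partial>W)"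
    by (intro nn_integral_cong) auto
  moreover have "{\<omega> \<in> space W. run P n \<omega>} \<in> sets W" by measurable
  ultimately show ?thesis by simp
qed

section \<open>Transforming every period by a symmetry of the Gaussian pair\<close>

lemma eval_zero: "\<omega> \<in> C0 \<Longrightarrow> \<omega> 0 = 0"
  by (simp add: C0_def)

lemma incr_sum: "fst (incr n \<omega>) + snd (incr n \<omega>) = \<omega> (2 * real n + 2) - \<omega> (2 * real n)"
  by (simp add: incr_def)

text \<open>Integrates out period n given the past. The factor \<open>h\<close> sees only whether
  the run goes on, and \<open>d\<close> lets one formula serve both the original and the rescaled
  path.\<close>

lemma nn_integral_run_step:
  fixes h :: "bool \<Rightarrow> ennreal"
  assumes [measurable]: "g \<in> borel_measurable borel" "R \<in> sets borel"
  shows "(\<integral>\<^sup>+ \<omega>. (if run R n \<omega> then h (incr n \<omega> \<in> R) * g (d * \<omega> (2 * real n + 2)) else 0) \<partial>W) =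
    (\<integral>\<^sup>+ \<omega>. (if run R n \<omega>
       then (\<integral>\<^sup>+ z. h (z \<in> R) * g (d * \<omega> (2 * real n) + d * (fst z + snd z)) \<partial>gauss2) else 0) \<partial>W)"
proof -
  have [measurable]: "Measurable.pred (raw_filtration (2 * real n)) (run R n)"
    by (rule pred_run_raw) simp_all
  have [measurable]: "(\<lambda>\<omega>. \<omega> (2 * real n)) \<in> borel_measurable (raw_filtration (2 * real n))"
    by (rule measurable_eval_raw) auto
  have [measurable]: "(\<lambda>z :: real \<times> real. fst z + snd z) \<in> borel_measurable borel"
    by (simp add: borel_prod[symmetric])
  have eq: "d * \<omega> (2 * real n + 2) = d * \<omega> (2 * real n) + d * (fst (incr n \<omega>) + snd (incr n \<omega>))" for \<omega>
    by (simp add: incr_sum algebra_simps)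
  have "(\<integral>\<^sup>+ \<omega>. (if run R n \<omega> then h (incr n \<omega> \<in> R) * g (d * \<omega> (2 * real n + 2)) else 0) \<partial>W) =
    (\<integral>\<^sup>+ \<omega>. (\<lambda>(\<omega>, z). if run R n \<omega>
       then h (z \<in> R) * g (d * \<omega> (2 * real n) + d * (fst z + snd z)) else 0) (\<omega>, incr n \<omega>) \<partial>W)"
    unfolding eq by simp
  also have "\<dots> = (\<integral>\<^sup>+ \<omega>. \<integral>\<^sup>+ z. (if run R n \<omega>
       then h (z \<in> R) * g (d * \<omega> (2 * real n) + d * (fst z + snd z)) else 0) \<partial>gauss2 \<partial>W)"
    by (subst nn_integral_incr) auto
  also have "\<dots> = (\<integral>\<^sup>+ \<omega>. (if run R n \<omega>
       then (\<integral>\<^sup>+ z. h (z \<in> R) * g (d * \<omega> (2 * real n) + d * (fst z + snd z)) \<partial>gauss2) else 0) \<partial>W)"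
    by (intro nn_integral_cong) auto
  finally show ?thesis .
qed

lemma measurable_run_step:
  fixes h :: "bool \<Rightarrow> ennreal"
  assumes [measurable]: "g \<in> borel_measurable borel" "R \<in> sets borel"
  shows "(\<lambda>x. \<integral>\<^sup>+ z. h (z \<in> R) * g (x + (fst z + snd z)) \<partial>gauss2) \<in> borel_measurable borel"
proof -
  have [measurable]: "(\<lambda>z :: real \<times> real. fst z + snd z) \<in> borel_measurable borel"
    by (simp add: borel_prod[symmetric])
  show ?thesis by measurable
qed

context
  fixes T :: "real \<times> real \<Rightarrow> real \<times> real" and P Q :: "(real \<times> real) set" and e :: real
  assumes T [measurable]: "T \<in> gauss2 \<rightarrow>\<^sub>M gauss2" and distr_T: "distr gauss2 gauss2 T = gauss2"
    and PQ [measurable]: "P \<in> sets borel" "Q \<in> sets borel"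
    and T_mem: "\<And>z. T z \<in> Q \<longleftrightarrow> z \<in> P"
    and T_sum: "\<And>z. fst (T z) + snd (T z) = e * (fst z + snd z)"
begin

text \<open>No map on paths is constructed; integrals are compared one period at a time. Integrating
  out period n leaves a function \<open>g'\<close> of the position at time 2n, the same on both
  sides by invariance under \<open>T\<close>, and \<open>IH\<close> applies to \<open>g'\<close>.
  The free factor \<open>h\<close> covers both continuation of the run and stopping.\<close>

lemma nn_integral_run_transform_aux:
  fixes h :: "bool \<Rightarrow> ennreal"
  assumes IH: "\<And>g. g \<in> borel_measurable borel \<Longrightarrow>
      (\<integral>\<^sup>+ \<omega>. (if run P n \<omega> then g (e * \<omega> (2 * real n)) else 0) \<partial>W) =
      (\<integral>\<^sup>+ \<omega>. (if run Q n \<omega> then g (\<omega> (2 * real n)) else 0) \<partial>W)"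
    and g [measurable]: "g \<in> borel_measurable borel"
  shows "(\<integral>\<^sup>+ \<omega>. (if run P n \<omega> then h (incr n \<omega> \<in> P) * g (e * \<omega> (2 * real n + 2)) else 0) \<partial>W) =
    (\<integral>\<^sup>+ \<omega>. (if run Q n \<omega> then h (incr n \<omega> \<in> Q) * g (\<omega> (2 * real n + 2)) else 0) \<partial>W)"
proof -
  define g' where "g' x = (\<integral>\<^sup>+ z. h (z \<in> Q) * g (x + (fst z + snd z)) \<partial>gauss2)" for x
  have g' [measurable]: "g' \<in> borel_measurable borel"
    unfolding g'_def by (rule measurable_run_step) measurable
  have [measurable]: "(\<lambda>z :: real \<times> real. fst z + snd z) \<in> borel_measurable borel"
    by (simp add: borel_prod[symmetric])
  have g'_eq: "g' x = (\<integral>\<^sup>+ z. h (z \<in> P) * g (x + e * (fst z + snd z)) \<partial>gauss2)" for x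
  proof -
    have "g' x = (\<integral>\<^sup>+ z. h (z \<in> Q) * g (x + (fst z + snd z)) \<partial>distr gauss2 gauss2 T)"
      by (simp add: g'_def distr_T)
    then show ?thesis
      by (subst (asm) nn_integral_distr) (measurable, simp add: T_mem T_sum)
  qed
  show ?thesis
    \<comment> \<open>The scaling \<open>d\<close> is \<open>e\<close> on the side of
      \<open>P\<close> and 1 on the side of \<open>Q\<close>; both inner integrals are then
      \<open>g'\<close>.\<close>
    using IH[OF g'] nn_integral_run_step[OF g PQ(1), of n h e] nn_integral_run_step[OF g PQ(2), of n h 1]
    unfolding g'_eq[symmetric] mult_1 g'_def[symmetric] by metis
qed

lemma nn_integral_run_transform:
  assumes "g \<in> borel_measurable borel"
  shows "(\<integral>\<^sup>+ \<omega>. (if run P n \<omega> then g (e * \<omega> (2 * real n)) else 0) \<partial>W) =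
    (\<integral>\<^sup>+ \<omega>. (if run Q n \<omega> then g (\<omega> (2 * real n)) else 0) \<partial>W)"
  using assms
proof (induction n arbitrary: g)
  case 0
  show ?case by (intro nn_integral_cong) (simp add: eval_zero)
next
  case (Suc n)
  \<comment> \<open>Continuation of the run is the special case \<open>h = of_bool\<close> of the
    auxiliary lemma.\<close>
  have *: "(if run R (Suc n) \<omega> then c else 0) =
      (if run R n \<omega> then of_bool (incr n \<omega> \<in> R) * c else 0)" for R \<omega> and c :: ennreal
    by (simp add: run_Suc)
  have eq: "2 * real (Suc n) = 2 * real n + 2" by simp
  show ?case
    unfolding * eq by (rule nn_integral_run_transform_aux[OF Suc])
qed

lemma nn_integral_run_stop_transform:
  fixes h :: "bool \<Rightarrow> ennreal"
  assumes "g \<in> borel_measurable borel"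
  shows "(\<integral>\<^sup>+ \<omega>. (if run P n \<omega> then h (incr n \<omega> \<in> P) * g (e * \<omega> (2 * real n + 2)) else 0) \<partial>W) =
    (\<integral>\<^sup>+ \<omega>. (if run Q n \<omega> then h (incr n \<omega> \<in> Q) * g (\<omega> (2 * real n + 2)) else 0) \<partial>W)"
  by (rule nn_integral_run_transform_aux[OF nn_integral_run_transform assms])

end

section \<open>Moments along a run\<close>

lemma nn_integral_even_moment:
  assumes "0 < t"
  shows "(\<integral>\<^sup>+ \<omega>. ennreal (\<omega> t ^ (2 * m)) \<partial>W) = ennreal (fact (2 * m) / fact m * (t / 2) ^ m)"
proof -
  let ?d = "normal_density 0 (sqrt t)"
  have "distributed W lborel (\<lambda>\<omega>. \<omega> t - \<omega> 0) (normal_density 0 (sqrt (t - 0)))"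
    using wiener assms unfolding wiener_measure_def by blast
  then have D: "distributed W lborel (\<lambda>\<omega>. \<omega> t - \<omega> 0) ?d" by simp
  have I: "has_bochner_integral lborel (\<lambda>x. ?d x * x ^ (2 * m)) (fact (2 * m) / fact m * (t / 2) ^ m)"
    using normal_moment_even[of "sqrt t" 0 m] assms by (simp add: power_divide field_simps)
  have "(\<integral>\<^sup>+ \<omega>. ennreal (\<omega> t ^ (2 * m)) \<partial>W) = (\<integral>\<^sup>+ \<omega>. ennreal ((\<omega> t - \<omega> 0) ^ (2 * m)) \<partial>W)"
    by (intro nn_integral_cong) (simp add: eval_zero)
  also have "\<dots> = (\<integral>\<^sup>+ x. ?d x * ennreal (x ^ (2 * m)) \<partial>lborel)"
    by (rule distributed_nn_integral[OF D, symmetric]) simp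
  also have "\<dots> = (\<integral>\<^sup>+ x. ennreal (?d x * x ^ (2 * m)) \<partial>lborel)"
    by (simp add: ennreal_mult'')
  also have "\<dots> = ennreal (fact (2 * m) / fact m * (t / 2) ^ m)"
    using I by (subst nn_integral_eq_integral)
      (auto simp: has_bochner_integral_iff normal_density_nonneg)
  finally show ?thesis .
qed

text \<open>Since the run has probability \<open>q ^ (2 * n)\<close>, the bound follows by integrating
  \<open>\<bar>x\<bar> ^ m \<le> 1 / q ^ n + q ^ n * x ^ (2 * m)\<close> over it.\<close>

lemma nn_integral_run_moment_le:
  assumes [measurable]: "P \<in> sets borel" and pos: "0 < measure gauss2 P"
  defines "q \<equiv> sqrt (measure gauss2 P)"
  shows "(\<integral>\<^sup>+ \<omega>. (if run P n \<omega> then ennreal (\<bar>\<omega> (2 * real n + 2)\<bar> ^ m) else 0) \<partial>W)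
    \<le> ennreal (q ^ n * (1 + fact (2 * m) / fact m * (real n + 1) ^ m))"
proof -
  have q: "q > 0" using pos by (simp add: q_def)
  have le: "\<bar>x\<bar> ^ m \<le> 1 / q ^ n + q ^ n * x ^ (2 * m)" for x :: real
  proof (cases "\<bar>x\<bar> ^ m \<le> 1 / q ^ n")
    case True
    then show ?thesis using q by (simp add: add_increasing2 power_mult)
  next
    case False
    then have "1 \<le> q ^ n * \<bar>x\<bar> ^ m" using q by (simp add: field_simps)
    then have "\<bar>x\<bar> ^ m * 1 \<le> \<bar>x\<bar> ^ m * (q ^ n * \<bar>x\<bar> ^ m)" by (intro mult_left_mono) auto
    also have "\<dots> = q ^ n * (\<bar>x\<bar> ^ m * \<bar>x\<bar> ^ m)" by (simp only: mult.left_commute)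
    also have "\<bar>x\<bar> ^ m * \<bar>x\<bar> ^ m = \<bar>x\<bar> ^ (2 * m)" by (simp only: mult_2 power_add)
    also have "\<dots> = x ^ (2 * m)" by (rule power_even_abs) simp
    finally show ?thesis using q by (simp add: add_increasing)
  qed
  have "(\<integral>\<^sup>+ \<omega>. (if run P n \<omega> then ennreal (\<bar>\<omega> (2 * real n + 2)\<bar> ^ m) else 0) \<partial>W)
    \<le> (\<integral>\<^sup>+ \<omega>. ennreal (1 / q ^ n) * indicator {\<omega> \<in> C0. run P n \<omega>} \<omega>
        + ennreal (q ^ n) * ennreal (\<omega> (2 * real n + 2) ^ (2 * m)) \<partial>W)"
    using q le by (intro nn_integral_mono)
      (simp add: indicator_def power_mult ennreal_leI flip: ennreal_mult'' ennreal_plus)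
  also have "\<dots> = ennreal (1 / q ^ n) * emeasure W {\<omega> \<in> C0. run P n \<omega>} +
      ennreal (q ^ n) * ennreal (fact (2 * m) / fact m * (real n + 1) ^ m)"
  proof -
    have [measurable]: "{\<omega> \<in> C0. run P n \<omega>} \<in> sets W"
      using pred_run[OF assms(1)] by (simp add: pred_def)
    have half: "(2 * real n + 2) / 2 = real n + 1" by simp
    have "(\<integral>\<^sup>+ \<omega>. ennreal (\<omega> (2 * real n + 2) ^ (2 * m)) \<partial>W)
        = ennreal (fact (2 * m) / fact m * (real n + 1) ^ m)"
      using nn_integral_even_moment[of "2 * real n + 2" m] unfolding half by simp
    then show ?thesis
      by (subst nn_integral_add) (simp_all add: nn_integral_cmult)
  qed
  also have "emeasure W {\<omega> \<in> C0. run P n \<omega>} = ennreal (q ^ n * q ^ n)"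
    using pos by (simp add: emeasure_run q_def flip: power_mult_distrib)
  also have "ennreal (1 / q ^ n) * ennreal (q ^ n * q ^ n) = ennreal (q ^ n)"
    using q by (simp flip: ennreal_mult'')
  also have "ennreal (q ^ n) + ennreal (q ^ n) * ennreal (fact (2 * m) / fact m * (real n + 1) ^ m)
      = ennreal (q ^ n * (1 + fact (2 * m) / fact m * (real n + 1) ^ m))"
    using q by (simp add: distrib_left flip: ennreal_mult'' ennreal_plus)
  finally show ?thesis .
qed

text \<open>Ratio test: the quotients tend to \<open>q\<close>, so they eventually lie below the
  midpoint \<open>(1 + q) / 2\<close> < 1. Geometric decay of run probabilities thus beats
  polynomial growth of times and moments.\<close>

lemma summable_geometric_power:
  fixes q :: real
  assumes "0 < q" "q < 1"
  shows "summable (\<lambda>n. q ^ n * (real n + 1) ^ m)"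
proof -
  have "(\<lambda>n. ((real n + 2) / (real n + 1)) ^ m * q) \<longlonglongrightarrow> 1 ^ m * q"
    by (intro tendsto_intros) real_asymp
  moreover have "1 ^ m * q < (1 + q) / 2" using assms by simp
  ultimately have "\<forall>\<^sub>F n in sequentially. ((real n + 2) / (real n + 1)) ^ m * q < (1 + q) / 2"
    by (rule order_tendstoD)
  then obtain N where N: "\<And>n. n \<ge> N \<Longrightarrow> ((real n + 2) / (real n + 1)) ^ m * q < (1 + q) / 2"
    by (auto simp: eventually_sequentially)
  show ?thesis
  proof (rule summable_ratio_test)
    show "(1 + q) / 2 < 1" using assms by simp
    fix n assume "N \<le> n"
    have "q ^ Suc n * (real (Suc n) + 1) ^ m
        = ((real n + 2) / (real n + 1)) ^ m * q * (q ^ n * (real n + 1) ^ m)"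
      by (simp add: power_divide add.commute)
    also have "\<dots> \<le> (1 + q) / 2 * (q ^ n * (real n + 1) ^ m)"
      using N[OF \<open>N \<le> n\<close>] assms by (intro mult_right_mono) auto
    finally show "norm (q ^ Suc n * (real (Suc n) + 1) ^ m)
        \<le> (1 + q) / 2 * norm (q ^ n * (real n + 1) ^ m)"
      using assms by simp
  qed
qed


section \<open>Stopping at even times\<close>

text \<open>Index n means stopping at the end of period n, so the earliest stop is at time
  2.\<close>

definition stop_at_even :: "(nat \<Rightarrow> path \<Rightarrow> real) \<Rightarrow> (path \<times> real) measure" where
  "stop_at_even w = distr (density (W \<Otimes>\<^sub>M count_space UNIV) (\<lambda>(\<omega>, n). ennreal (w n \<omega>)))
     (W \<Otimes>\<^sub>M time_borel) (\<lambda>(\<omega>, n). (\<omega>, 2 * real n + 2))"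

text \<open>The disintegration of \<open>stop_at_even w\<close> over the path.\<close>

definition even_kernel :: "(nat \<Rightarrow> path \<Rightarrow> real) \<Rightarrow> path \<Rightarrow> real measure" where
  "even_kernel w \<omega> =
     distr (density (count_space UNIV) (\<lambda>n. ennreal (w n \<omega>))) time_borel (\<lambda>n. 2 * real n + 2)"

lemma sets_stop_at_even [simp]: "sets (stop_at_even w) = sets (W \<Otimes>\<^sub>M time_borel)"
  and space_stop_at_even [simp]: "space (stop_at_even w) = C0 \<times> {0..}"
  by (simp_all add: stop_at_even_def space_pair_measure space_restrict_space)

lemma measurable_even_times [measurable]: "(\<lambda>n. 2 * real n + 2) \<in> count_space UNIV \<rightarrow>\<^sub>M time_borel"
  by (auto intro!: measurable_restrict_space2)

lemma nn_integral_stop_at_even: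
  assumes w [measurable]: "\<And>n. w n \<in> borel_measurable W"
    and f [measurable]: "f \<in> borel_measurable (W \<Otimes>\<^sub>M time_borel)"
  shows "(\<integral>\<^sup>+ x. f x \<partial>stop_at_even w) = (\<Sum>n. \<integral>\<^sup>+ \<omega>. ennreal (w n \<omega>) * f (\<omega>, 2 * real n + 2) \<partial>W)"
proof -
  interpret C: sigma_finite_measure "count_space (UNIV :: nat set)"
    by (rule sigma_finite_measure_count_space)
  have [measurable]: "(\<lambda>(\<omega>, n). ennreal (w n \<omega>)) \<in> borel_measurable (W \<Otimes>\<^sub>M count_space UNIV)"
    unfolding case_prod_beta
    by (rule measurable_compose_countable[where f = "\<lambda>n x. ennreal (w n (fst x))" and g = snd]) measurable
  have [measurable]: "(\<lambda>\<omega>. f (\<omega>, 2 * real n + 2)) \<in> borel_measurable W" for n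
    by (rule measurable_compose[OF _ f]) (auto intro!: measurable_Pair simp: space_restrict_space)
  have "(\<integral>\<^sup>+ x. f x \<partial>stop_at_even w)
      = (\<integral>\<^sup>+ x. (case x of (\<omega>, n) \<Rightarrow> ennreal (w n \<omega>)) * f (case x of (\<omega>, n) \<Rightarrow> (\<omega>, 2 * real n + 2))
          \<partial>(W \<Otimes>\<^sub>M count_space UNIV))"
    unfolding stop_at_even_def
    by (subst nn_integral_distr, simp, simp) (subst nn_integral_density, simp_all)
  also have "\<dots> = (\<integral>\<^sup>+ \<omega>. \<integral>\<^sup>+ n. ennreal (w n \<omega>) * f (\<omega>, 2 * real n + 2) \<partial>count_space UNIV \<partial>W)"
    by (subst C.nn_integral_fst[symmetric]) auto
  also have "\<dots> = (\<integral>\<^sup>+ \<omega>. (\<Sum>n. ennreal (w n \<omega>) * f (\<omega>, 2 * real n + 2)) \<partial>W)"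
    by (simp add: nn_integral_count_space_nat)
  also have "\<dots> = (\<Sum>n. \<integral>\<^sup>+ \<omega>. ennreal (w n \<omega>) * f (\<omega>, 2 * real n + 2) \<partial>W)"
    by (rule nn_integral_suminf) measurable
  finally show ?thesis .
qed

lemma sets_even_kernel [simp]: "sets (even_kernel w \<omega>) = sets time_borel"
  and space_even_kernel [simp]: "space (even_kernel w \<omega>) = {0..}"
  by (simp_all add: even_kernel_def space_restrict_space)

lemma emeasure_even_kernel:
  assumes "A \<in> sets time_borel"
  shows "emeasure (even_kernel w \<omega>) A = (\<Sum>n. ennreal (w n \<omega>) * indicator A (2 * real n + 2))"
proof -
  have "emeasure (even_kernel w \<omega>) A = (\<integral>\<^sup>+ t. indicator A t \<partial>even_kernel w \<omega>)"
    using assms by simp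
  also have "\<dots> = (\<integral>\<^sup>+ n. ennreal (w n \<omega>) * indicator A (2 * real n + 2) \<partial>count_space UNIV)"
    unfolding even_kernel_def using assms
    by (subst nn_integral_distr, simp, simp) (subst nn_integral_density, simp_all)
  finally show ?thesis by (simp add: nn_integral_count_space_nat)
qed

text \<open>Adaptedness holds because \<open>w n\<close> is known at time 2n + 2, the time at which
  its mass is placed. The bound on partial sums is required on every path so that the kernel is
  subprobability-valued throughout; full mass is an almost sure statement.\<close>

lemma randomized_stopping_time_stop_at_even:
  assumes w [measurable]: "\<And>n. w n \<in> borel_measurable (raw_filtration (2 * real n + 2))"
    and nonneg: "\<And>n \<omega>. \<omega> \<in> C0 \<Longrightarrow> 0 \<le> w n \<omega>"
    and le_1: "\<And>N \<omega>. \<omega> \<in> C0 \<Longrightarrow> (\<Sum>n<N. w n \<omega>) \<le> 1"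
    and AE_1: "AE \<omega> in W. (\<Sum>n. ennreal (w n \<omega>)) = 1"
  shows "randomized_stopping_time W (stop_at_even w)"
proof -
  have w' [measurable]: "w n \<in> borel_measurable W" for n
    by (rule measurable_from_raw) (rule w)
  have sub: "subprob_space (even_kernel w \<omega>)" if "\<omega> \<in> C0" for \<omega>
  proof
    have "(\<Sum>n. ennreal (w n \<omega>)) \<le> 1"
    proof (rule suminf_le_const)
      fix N
      have "(\<Sum>n<N. ennreal (w n \<omega>)) = ennreal (\<Sum>n<N. w n \<omega>)"
        using nonneg[OF that] by simp
      also have "\<dots> \<le> 1" using le_1[OF that] by simp
      finally show "(\<Sum>n<N. ennreal (w n \<omega>)) \<le> 1" .
    qed simp
    moreover have "{0..} \<in> sets time_borel" by (auto simp: sets_restrict_space)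
    ultimately show "emeasure (even_kernel w \<omega>) (space (even_kernel w \<omega>)) \<le> 1"
      by (simp add: emeasure_even_kernel)
  qed simp
  have kernel: "even_kernel w \<in> W \<rightarrow>\<^sub>M subprob_algebra time_borel"
  proof (rule measurable_subprob_algebra)
    show "(\<lambda>\<omega>. emeasure (even_kernel w \<omega>) A) \<in> borel_measurable W" if "A \<in> sets time_borel" for A
      using that by (simp add: emeasure_even_kernel)
  qed (use sub in simp_all)
  have top: "{0..} \<in> sets time_borel" by (auto simp: sets_restrict_space)
  have mass: "AE \<omega> in W. emeasure (even_kernel w \<omega>) {0..} = 1"
    using AE_1 by (simp add: emeasure_even_kernel[OF top])
  have slices: "emeasure (stop_at_even w) X = (\<integral>\<^sup>+ \<omega>. emeasure (even_kernel w \<omega>) (Pair \<omega> -` X) \<partial>W)"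
    if X [measurable]: "X \<in> sets (W \<Otimes>\<^sub>M time_borel)" for X
  proof -
    have "(\<lambda>\<omega>. ennreal (w n \<omega>) * indicator X (\<omega>, 2 * real n + 2)) \<in> borel_measurable W" for n
      by (intro borel_measurable_times_ennreal measurable_compose[OF _ borel_measurable_indicator[OF X]])
        (auto intro!: measurable_Pair simp: space_restrict_space)
    then have "emeasure (stop_at_even w) X
        = (\<integral>\<^sup>+ \<omega>. (\<Sum>n. ennreal (w n \<omega>) * indicator X (\<omega>, 2 * real n + 2)) \<partial>W)"
      using X nn_integral_stop_at_even[of w "indicator X"] by (simp add: nn_integral_suminf)
    then show ?thesis
      using sets_Pair1[OF X] by (simp add: emeasure_even_kernel indicator_vimage[symmetric] o_def)
  qed
  have "prob_space (stop_at_even w)"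
  proof
    have S: "C0 \<times> {0..} \<in> sets (W \<Otimes>\<^sub>M time_borel)"
      using sets.top[of "W \<Otimes>\<^sub>M time_borel"] by (simp add: space_pair_measure space_restrict_space)
    have "emeasure (stop_at_even w) (space (stop_at_even w))
        = (\<integral>\<^sup>+ \<omega>. emeasure (even_kernel w \<omega>) (Pair \<omega> -` (C0 \<times> {0..})) \<partial>W)"
      using slices[OF S] by simp
    also have "\<dots> = (\<integral>\<^sup>+ \<omega>. emeasure (even_kernel w \<omega>) {0..} \<partial>W)"
      by (intro nn_integral_cong arg_cong2[where f = emeasure]) auto
    also have "\<dots> = (\<integral>\<^sup>+ \<omega>. 1 \<partial>W)"
      by (intro nn_integral_cong_AE mass)
    finally show "emeasure (stop_at_even w) (space (stop_at_even w)) = 1"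
      using emeasure_space_1 by simp
  qed
  moreover have "(\<lambda>\<omega>. emeasure (even_kernel w \<omega>) {0..t}) \<in> borel_measurable (raw_filtration t)"
    if "0 \<le> t" for t
  proof -
    have "(\<lambda>\<omega>. ennreal (w n \<omega>) * indicator {0..t} (2 * real n + 2)) \<in> borel_measurable (raw_filtration t)" for n
    \<comment> \<open>A weight not yet known at time \<open>t\<close> is multiplied by a vanishing
      indicator.\<close>
    proof (cases "2 * real n + 2 \<le> t")
      case True
      have [measurable]: "w n \<in> borel_measurable (raw_filtration t)"
        using measurable_compose[OF measurable_id_raw_filtration[OF True] w] by simp
      show ?thesis by measurable
    qed simp
    moreover have "{0..t} \<in> sets time_borel" by (auto simp: sets_restrict_space image_iff)
    ultimately show ?thesis by (simp add: emeasure_even_kernel)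
  qed
  ultimately show ?thesis
    unfolding randomized_stopping_time_def using kernel mass slices by auto
qed


section \<open>The law of the stopped process\<close>

lemma measurable_run_weight [measurable (raw)]:
  "P \<in> sets borel \<Longrightarrow> run_weight P s n \<in> borel_measurable W"
  by (rule measurable_from_raw[OF measurable_run_weight_raw])

lemma measurable_mixed_weight [measurable (raw)]: "mixed_weight s t n \<in> borel_measurable W"
  by (rule measurable_from_raw[OF measurable_mixed_weight_raw])

text \<open>The shape to which \<open>nn_integral_run_stop_transform\<close> applies.\<close>

lemma run_weight_conv:
  "ennreal (run_weight P s n \<omega>) * c =
    (if run P n \<omega> then (\<lambda>b. ennreal (s n - (if b then s (Suc n) else 0))) (incr n \<omega> \<in> P) * c else 0)"
  by (simp add: run_weight_def)

lemma nn_integral_run_weight_swap: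
  assumes "g \<in> borel_measurable borel"
  shows "(\<integral>\<^sup>+ \<omega>. ennreal (run_weight down_up s n \<omega>) * g (\<omega> (2 * real n + 2)) \<partial>W) =
    (\<integral>\<^sup>+ \<omega>. ennreal (run_weight up_down s n \<omega>) * g (\<omega> (2 * real n + 2)) \<partial>W)"
proof -
  have "(case z of (x, y) \<Rightarrow> (y, x)) \<in> up_down \<longleftrightarrow> z \<in> down_up" for z
    by (cases z) (auto simp: up_down_def down_up_def)
  note * = nn_integral_run_stop_transform[OF measurable_gauss2_swap distr_gauss2_swap
      down_up_borel up_down_borel this, of 1]
  show ?thesis
    unfolding run_weight_conv using *[where n = n and h = "\<lambda>b. ennreal (s n - (if b then s (Suc n) else 0))", OF _ assms] by (simp add: case_prod_beta add.commute cong: if_cong)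
qed

text \<open>Negation turns up-down runs into down-up runs and reflects the position; the swap then
  restores the kind of run without moving the position.\<close>

lemma nn_integral_run_weight_uminus:
  assumes g: "g \<in> borel_measurable borel"
  shows "(\<integral>\<^sup>+ \<omega>. ennreal (run_weight up_down s n \<omega>) * g (- \<omega> (2 * real n + 2)) \<partial>W) =
    (\<integral>\<^sup>+ \<omega>. ennreal (run_weight up_down s n \<omega>) * g (\<omega> (2 * real n + 2)) \<partial>W)"
proof -
  have "(case z of (x, y) \<Rightarrow> (- x, - y)) \<in> down_up \<longleftrightarrow> z \<in> up_down" for z
    by (cases z) (auto simp: up_down_def down_up_def)
  note * = nn_integral_run_stop_transform[OF measurable_gauss2_uminus distr_gauss2_uminus
      up_down_borel down_up_borel this, of "-1"]
  show ?thesis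
    unfolding nn_integral_run_weight_swap[OF g, symmetric]
    unfolding run_weight_conv using *[where n = n and h = "\<lambda>b. ennreal (s n - (if b then s (Suc n) else 0))", OF _ g] by (simp add: case_prod_beta cong: if_cong)
qed

text \<open>The swap moves the down-up branch onto the up-down run, leaving a sum that is symmetric
  in \<open>s\<close> and \<open>t\<close>.\<close>

lemma nn_integral_mixed_weight:
  assumes [measurable]: "g \<in> borel_measurable borel" and s: "survival s" and t: "survival t"
  shows "(\<integral>\<^sup>+ \<omega>. ennreal (mixed_weight s t n \<omega>) * g (\<omega> (2 * real n + 2)) \<partial>W) =
    (\<integral>\<^sup>+ \<omega>. ennreal (run_weight up_down s n \<omega>) * g (\<omega> (2 * real n + 2)) \<partial>W) / 2 +
    (\<integral>\<^sup>+ \<omega>. ennreal (run_weight up_down t n \<omega>) * g (\<omega> (2 * real n + 2)) \<partial>W) / 2"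
proof -
  have "ennreal (mixed_weight s t n \<omega>) =
      ennreal (run_weight up_down s n \<omega>) / 2 + ennreal (run_weight down_up t n \<omega>) / 2" for \<omega>
    using run_weight_nonneg[OF s] run_weight_nonneg[OF t]
      divide_ennreal[of "run_weight up_down s n \<omega>" 2] divide_ennreal[of "run_weight down_up t n \<omega>" 2]
    by (simp add: mixed_weight_def add_divide_distrib)
  then have "ennreal (mixed_weight s t n \<omega>) * g (\<omega> (2 * real n + 2)) =
      ennreal (run_weight up_down s n \<omega>) * g (\<omega> (2 * real n + 2)) / 2 +
      ennreal (run_weight down_up t n \<omega>) * g (\<omega> (2 * real n + 2)) / 2" for \<omega>
    by (simp add: distrib_left distrib_right divide_ennreal_def ac_simps)
  then show ?thesis
    by (simp add: nn_integral_add nn_integral_divide nn_integral_run_weight_swap)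
qed

text \<open>By continuity of paths, evaluation is the pointwise limit of evaluations at the time
  rounded down to the grid of mesh \<open>1 / Suc i\<close>, each measurable because the grid is
  countable.\<close>

lemma measurable_eval_joint [measurable]:
  "(\<lambda>(\<omega>, t). \<omega> t) \<in> borel_measurable (W \<Otimes>\<^sub>M time_borel)"
proof (rule borel_measurable_LIMSEQ_real)
  fix i
  have "(\<lambda>t :: real. nat \<lfloor>real (Suc i) * t\<rfloor>) \<in> time_borel \<rightarrow>\<^sub>M count_space UNIV"
    by (rule measurable_restrict_space1) measurable
  then have N: "(\<lambda>x. nat \<lfloor>real (Suc i) * snd x\<rfloor>) \<in> W \<Otimes>\<^sub>M time_borel \<rightarrow>\<^sub>M count_space UNIV"
    by (rule measurable_compose[OF measurable_snd])
  have "(\<lambda>x. fst x (real k / real (Suc i))) \<in> borel_measurable (W \<Otimes>\<^sub>M time_borel)" for k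
    by (rule measurable_compose[OF measurable_fst measurable_eval]) simp
  from measurable_compose_countable[OF this N]
  show "(\<lambda>x. fst x (real (nat \<lfloor>real (Suc i) * snd x\<rfloor>) / real (Suc i))) \<in> borel_measurable (W \<Otimes>\<^sub>M time_borel)" .
next
  fix x assume "x \<in> space (W \<Otimes>\<^sub>M time_borel)"
  then obtain \<omega> t where x: "x = (\<omega>, t)" and \<omega>: "\<omega> \<in> C0" and t: "0 \<le> t"
    by (auto simp: space_pair_measure space_restrict_space)
  let ?u = "\<lambda>i. real (nat \<lfloor>real (Suc i) * t\<rfloor>) / real (Suc i)"
  have "?u \<longlonglongrightarrow> t"
  proof (rule tendsto_sandwich)
    have "t - inverse (real (Suc i)) \<le> ?u i" for i
    proof -
      have "real (Suc i) * t - 1 \<le> real (nat \<lfloor>real (Suc i) * t\<rfloor>)" using t by linarith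
      then have "(real (Suc i) * t - 1) / real (Suc i) \<le> ?u i" by (intro divide_right_mono) auto
      then show ?thesis by (simp add: diff_divide_distrib inverse_eq_divide)
    qed
    then show "\<forall>\<^sub>F i in sequentially. t - inverse (real (Suc i)) \<le> ?u i" by simp
    have "?u i \<le> t" for i
    proof -
      have "real (nat \<lfloor>real (Suc i) * t\<rfloor>) \<le> real (Suc i) * t"
        using t by (simp add: of_nat_floor)
      then show ?thesis by (simp add: divide_le_eq mult.commute)
    qed
    then show "\<forall>\<^sub>F i in sequentially. ?u i \<le> t" by simp
    show "(\<lambda>i. t - inverse (real (Suc i))) \<longlonglongrightarrow> t"
      using tendsto_diff[OF tendsto_const LIMSEQ_inverse_real_of_nat, of t] by simp
  qed simp
  moreover have "continuous_on {0..} \<omega>" using \<omega> by (simp add: C0_def)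
  ultimately have "(\<lambda>i. \<omega> (?u i)) \<longlonglongrightarrow> \<omega> t"
    using t by (intro continuous_on_tendsto_compose[of "{0..}" \<omega>]) auto
  then show "(\<lambda>i. fst x (real (nat \<lfloor>real (Suc i) * snd x\<rfloor>) / real (Suc i)))
      \<longlonglongrightarrow> (case x of (\<omega>, t) \<Rightarrow> \<omega> t)"
    by (simp add: x)
qed

abbreviation mixed_stop :: "(nat \<Rightarrow> real) \<Rightarrow> (nat \<Rightarrow> real) \<Rightarrow> (path \<times> real) measure" where
  "mixed_stop s t \<equiv> stop_at_even (mixed_weight s t)"

abbreviation stopped_dist_law :: "(nat \<Rightarrow> real) \<Rightarrow> (nat \<Rightarrow> real) \<Rightarrow> real measure" where
  "stopped_dist_law s t \<equiv> distr (mixed_stop s t) borel (\<lambda>(\<omega>, t). \<omega> t)"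

lemma measurable_eval_mixed_stop [measurable]:
  "(\<lambda>(\<omega>, t). \<omega> t) \<in> borel_measurable (stop_at_even w)"
  using measurable_eval_joint by (simp cong: measurable_cong_sets)

lemma nn_integral_stopped_dist_law:
  assumes [measurable]: "g \<in> borel_measurable borel"
  shows "(\<integral>\<^sup>+ x. g x \<partial>stopped_dist_law s t) =
    (\<Sum>n. \<integral>\<^sup>+ \<omega>. ennreal (mixed_weight s t n \<omega>) * g (\<omega> (2 * real n + 2)) \<partial>W)"
proof -
  have G: "(\<lambda>x. g (case x of (\<omega>, t) \<Rightarrow> \<omega> t)) \<in> borel_measurable (W \<Otimes>\<^sub>M time_borel)"
    by (rule measurable_compose[OF measurable_eval_joint assms])
  have "(\<integral>\<^sup>+ x. g x \<partial>stopped_dist_law s t) = (\<integral>\<^sup>+ x. g (case x of (\<omega>, t) \<Rightarrow> \<omega> t) \<partial>mixed_stop s t)"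
    using assms by (intro nn_integral_distr measurable_eval_mixed_stop) simp
  then show ?thesis
    using nn_integral_stop_at_even[of "mixed_weight s t", OF measurable_mixed_weight G] by simp
qed

lemma stopped_dist_law_commute:
  assumes "survival s" "survival t"
  shows "stopped_dist_law s t = stopped_dist_law t s"
proof (rule measure_eqI)
  fix A assume "A \<in> sets (stopped_dist_law s t)"
  then have A [measurable]: "A \<in> sets borel" by simp
  have "(\<integral>\<^sup>+ \<omega>. ennreal (mixed_weight s t n \<omega>) * indicator A (\<omega> (2 * real n + 2)) \<partial>W) =
      (\<integral>\<^sup>+ \<omega>. ennreal (mixed_weight t s n \<omega>) * indicator A (\<omega> (2 * real n + 2)) \<partial>W)" for n
    unfolding nn_integral_mixed_weight[of "indicator A", OF borel_measurable_indicator[OF A] assms]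
      nn_integral_mixed_weight[of "indicator A", OF borel_measurable_indicator[OF A] assms(2,1)]
    by (rule add.commute)
  then show "emeasure (stopped_dist_law s t) A = emeasure (stopped_dist_law t s) A"
    using nn_integral_stopped_dist_law[of "indicator A" s t] nn_integral_stopped_dist_law[of "indicator A" t s]
    by simp
qed simp

lemma stopped_dist_law_uminus:
  assumes "survival s" "survival t"
  shows "distr (stopped_dist_law s t) borel uminus = stopped_dist_law s t"
proof (rule measure_eqI)
  fix A assume "A \<in> sets (distr (stopped_dist_law s t) borel uminus)"
  then have A [measurable]: "A \<in> sets borel" by simp
  have [measurable]: "(\<lambda>x. indicator A (- x) :: ennreal) \<in> borel_measurable borel" by measurable
  have "emeasure (distr (stopped_dist_law s t) borel uminus) A
      = (\<integral>\<^sup>+ x. indicator A x \<partial>distr (stopped_dist_law s t) borel uminus)"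
    by simp
  also have "\<dots> = (\<integral>\<^sup>+ x. indicator A (- x) \<partial>stopped_dist_law s t)"
    by (rule nn_integral_distr) auto
  also have "\<dots> = (\<integral>\<^sup>+ x. indicator A x \<partial>stopped_dist_law s t)"
    using assms
    by (simp add: nn_integral_stopped_dist_law nn_integral_mixed_weight[of "\<lambda>x. indicator A (- x)"]
        nn_integral_mixed_weight[of "indicator A"] nn_integral_run_weight_uminus[of "indicator A"]
        del: nn_integral_indicator)
  finally show "emeasure (distr (stopped_dist_law s t) borel uminus) A = emeasure (stopped_dist_law s t) A"
    by simp
qed simp


section \<open>Membership in the set of embeddings\<close>

lemma measure_up_down: "measure gauss2 up_down = p_up"
  by (simp add: p_up_def)

lemma sets_run: "P \<in> sets borel \<Longrightarrow> {\<omega> \<in> space W. run P n \<omega>} \<in> sets W"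
  using pred_run unfolding pred_def by blast

lemma AE_run_ends:
  assumes [measurable]: "P \<in> sets borel" and p: "measure gauss2 P < 1"
  shows "AE \<omega> in W. \<exists>N. \<not> run P N \<omega>"
proof (rule AE_I')
  let ?p = "measure gauss2 P" and ?A = "{\<omega> \<in> space W. \<forall>N. run P N \<omega>}"
  have A: "?A \<in> sets W"
    by (intro sets.sets_Collect_countable_All sets_run assms(1))
  have "measure W ?A \<le> ?p ^ N" for N
  proof -
    have "measure W ?A \<le> measure W {\<omega> \<in> space W. run P N \<omega>}"
      by (rule finite_measure_mono) (use sets_run in auto)
    also have "\<dots> = ?p ^ N"
      using emeasure_run[of P N] by (simp add: emeasure_eq_measure)
    finally show ?thesis .
  qed
  moreover have "(\<lambda>N. ?p ^ N) \<longlonglongrightarrow> 0" using p by (intro LIMSEQ_power_zero) simp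
  ultimately have "measure W ?A \<le> 0" by (intro LIMSEQ_le_const) auto
  then show "?A \<in> null_sets W"
    using A by (simp add: null_sets_def emeasure_eq_measure measure_le_0_iff)
qed auto

text \<open>Mass can be missing only on paths with a run that never ends, which form a null set.
  Once both runs have broken, the partial sums equal 1 exactly.\<close>

lemma randomized_stopping_time_mixed_stop:
  assumes s: "survival s" and t: "survival t"
  shows "randomized_stopping_time W (mixed_stop s t)"
proof (rule randomized_stopping_time_stop_at_even)
  show "mixed_weight s t n \<in> borel_measurable (raw_filtration (2 * real n + 2))" for n
    by (rule measurable_mixed_weight_raw)
  show "0 \<le> mixed_weight s t n \<omega>" for n \<omega>
    using s t by (rule mixed_weight_nonneg)
  show "(\<Sum>n<N. mixed_weight s t n \<omega>) \<le> 1" for N \<omega>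
    using s t by (auto simp: sum_mixed_weight survival_def intro: less_imp_le add_nonneg_nonneg)
  have "AE \<omega> in W. \<exists>N. \<not> run up_down N \<omega>"
    by (rule AE_run_ends) (simp_all add: measure_up_down p_up_less_1)
  moreover have "AE \<omega> in W. \<exists>N. \<not> run down_up N \<omega>"
    by (rule AE_run_ends) (simp_all add: measure_down_up p_up_less_1)
  ultimately show "AE \<omega> in W. (\<Sum>n. ennreal (mixed_weight s t n \<omega>)) = 1"
  proof eventually_elim
    case (elim \<omega>)
    then obtain M N where "\<not> run up_down M \<omega>" "\<not> run down_up N \<omega>" by blast
    then have no: "\<not> run up_down k \<omega>" "\<not> run down_up k \<omega>" if "k \<ge> max M N" for k
      using that run_antimono by (metis max.boundedE)+
    have "(\<lambda>k. \<Sum>n<k. mixed_weight s t n \<omega>) \<longlonglongrightarrow> 1"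
      by (rule tendsto_eventually, rule eventually_sequentiallyI[of "max M N"])
        (simp add: sum_mixed_weight s t no)
    then have "(\<lambda>n. mixed_weight s t n \<omega>) sums 1" by (simp add: sums_def)
    then show ?case
      using mixed_weight_nonneg[OF s t] by (subst suminf_ennreal2) (auto simp: sums_iff)
  qed
qed

text \<open>The weight is at most 1 and vanishes unless one of the two runs has lasted n
  periods.\<close>

lemma nn_integral_mixed_weight_le:
  assumes s: "survival s" and t: "survival t" and [measurable]: "f \<in> borel_measurable W"
    and up: "(\<integral>\<^sup>+ \<omega>. (if run up_down n \<omega> then f \<omega> else 0) \<partial>W) \<le> ennreal c"
    and down: "(\<integral>\<^sup>+ \<omega>. (if run down_up n \<omega> then f \<omega> else 0) \<partial>W) \<le> ennreal c"
    and c: "0 \<le> c"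
  shows "(\<integral>\<^sup>+ \<omega>. ennreal (mixed_weight s t n \<omega>) * f \<omega> \<partial>W) \<le> ennreal (2 * c)"
proof -
  have "(\<integral>\<^sup>+ \<omega>. ennreal (mixed_weight s t n \<omega>) * f \<omega> \<partial>W) \<le>
      (\<integral>\<^sup>+ \<omega>. (if run up_down n \<omega> then f \<omega> else 0) + (if run down_up n \<omega> then f \<omega> else 0) \<partial>W)"
  proof (rule nn_integral_mono)
    fix \<omega>
    show "ennreal (mixed_weight s t n \<omega>) * f \<omega> \<le>
        (if run up_down n \<omega> then f \<omega> else 0) + (if run down_up n \<omega> then f \<omega> else 0)"
    proof (cases "run up_down n \<omega> \<or> run down_up n \<omega>")
      case True
      have "mixed_weight s t n \<omega> \<le> 1"
        using run_weight_le[OF s, of up_down n \<omega>] run_weight_le[OF t, of down_up n \<omega>]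
        by (simp add: mixed_weight_def of_bool_def split: if_splits)
      then have "ennreal (mixed_weight s t n \<omega>) * f \<omega> \<le> 1 * f \<omega>"
        by (intro mult_right_mono) auto
      also have "\<dots> \<le> (if run up_down n \<omega> then f \<omega> else 0) + (if run down_up n \<omega> then f \<omega> else 0)"
        using True by auto
      finally show ?thesis .
    next
      case False
      then show ?thesis using mixed_weight_eq_0_iff[OF s t, of n \<omega>] by simp
    qed
  qed
  also have "\<dots> = (\<integral>\<^sup>+ \<omega>. (if run up_down n \<omega> then f \<omega> else 0) \<partial>W)
      + (\<integral>\<^sup>+ \<omega>. (if run down_up n \<omega> then f \<omega> else 0) \<partial>W)"
    by (rule nn_integral_add) measurable
  also have "\<dots> \<le> ennreal c + ennreal c" using up down by (rule add_mono)
  also have "\<dots> = ennreal (2 * c)" using c by (simp flip: ennreal_plus)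
  finally show ?thesis .
qed

lemma mixed_stop_integrable_time:
  assumes s: "survival s" and t: "survival t"
  shows "(\<integral>\<^sup>+ (\<omega>, t). ennreal t \<partial>mixed_stop s t) < \<infinity>"
proof -
  have "(\<lambda>t :: real. t) \<in> borel_measurable time_borel" by (rule measurable_restrict_space1) simp
  then have [measurable]: "snd \<in> borel_measurable (W \<Otimes>\<^sub>M time_borel)"
    using measurable_compose[OF measurable_snd] by simp
  have run: "(\<integral>\<^sup>+ \<omega>. (if run P n \<omega> then ennreal (2 * real n + 2) else 0) \<partial>W)
      \<le> ennreal (p_up ^ n * (2 * real n + 2))"
    if [measurable]: "P \<in> sets borel" and P: "measure gauss2 P = p_up" for P n
  proof -
    have "(\<integral>\<^sup>+ \<omega>. (if run P n \<omega> then ennreal (2 * real n + 2) else 0) \<partial>W) =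
      (\<integral>\<^sup>+ \<omega>. ennreal (2 * real n + 2) * indicator {\<omega> \<in> space W. run P n \<omega>} \<omega> \<partial>W)"
      by (intro nn_integral_cong) auto
    also have "\<dots> = ennreal (2 * real n + 2) * ennreal (p_up ^ n)"
      using sets_run emeasure_run[of P n] P by (simp add: nn_integral_cmult_indicator)
    also have "\<dots> = ennreal (p_up ^ n * (2 * real n + 2))"
      using p_up_pos by (subst ennreal_mult[symmetric]) (simp_all add: mult.commute)
    finally show ?thesis by simp
  qed
  have sm: "summable (\<lambda>n. 2 * (p_up ^ n * (2 * real n + 2)))"
    using summable_mult[OF summable_geometric_power[OF p_up_pos p_up_less_1, of 1], of 4]
    by (simp add: algebra_simps)
  have "(\<integral>\<^sup>+ (\<omega>, t). ennreal t \<partial>mixed_stop s t)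
      = (\<Sum>n. \<integral>\<^sup>+ \<omega>. ennreal (mixed_weight s t n \<omega>) * ennreal (2 * real n + 2) \<partial>W)"
    by (subst nn_integral_stop_at_even) (auto simp: case_prod_beta)
  also have "\<dots> \<le> (\<Sum>n. ennreal (2 * (p_up ^ n * (2 * real n + 2))))"
    using p_up_pos by (intro suminf_le nn_integral_mixed_weight_le s t run) (auto simp: measure_up_down measure_down_up)
  also have "\<dots> < \<infinity>"
    using sm p_up_pos by (subst suminf_ennreal2) auto
  finally show ?thesis .
qed

lemma mixed_stop_in_embeddings:
  "survival s \<Longrightarrow> survival t \<Longrightarrow> mixed_stop s t \<in> embeddings W (stopped_dist_law s t)"
  unfolding embeddings_def using randomized_stopping_time_mixed_stop mixed_stop_integrable_time by blast

lemma prob_space_stopped_dist_law: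
  assumes "survival s" "survival t"
  shows "prob_space (stopped_dist_law s t)"
  using randomized_stopping_time_mixed_stop[OF assms]
  by (intro prob_space.prob_space_distr measurable_eval_mixed_stop) (simp add: randomized_stopping_time_def)

lemma integrable_stopped_dist_law_power:
  assumes s: "survival s" and t: "survival t"
  shows "integrable (stopped_dist_law s t) (\<lambda>x. x ^ m)"
proof (rule integrableI_bounded)
  \<comment> \<open>The square root comes from \<open>nn_integral_run_moment_le\<close>, where only
    half of the exponential decay of the run is left after paying for the moment.\<close>
  define q where "q = sqrt p_up"
  have q: "0 < q" "q < 1"
    using p_up_pos p_up_less_1 by (auto simp: q_def)
  define C :: real where "C = fact (2 * m) / fact m"
  have C: "0 \<le> C" by (simp add: C_def)
  have sm: "summable (\<lambda>n. 2 * (q ^ n * (1 + C * (real n + 1) ^ m)))"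
    using summable_geometric_power[OF q, of 0] summable_geometric_power[OF q, of m]
    by (simp add: distrib_left mult.left_commute[of _ C] summable_add summable_mult)
  have "(\<integral>\<^sup>+ x. ennreal (norm (x ^ m)) \<partial>stopped_dist_law s t)
      = (\<Sum>n. \<integral>\<^sup>+ \<omega>. ennreal (mixed_weight s t n \<omega>) * ennreal (\<bar>\<omega> (2 * real n + 2)\<bar> ^ m) \<partial>W)"
    by (subst nn_integral_stopped_dist_law) (auto simp: power_abs)
  also have "\<dots> \<le> (\<Sum>n. ennreal (2 * (q ^ n * (1 + C * (real n + 1) ^ m))))"
    using nn_integral_run_moment_le[of up_down _ m] nn_integral_run_moment_le[of down_up _ m] q C p_up_pos
    by (intro suminf_le nn_integral_mixed_weight_le s t)
      (auto simp: measure_up_down measure_down_up q_def C_def)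
  also have "\<dots> < \<infinity>"
    using sm q C by (subst suminf_ennreal2) auto
  finally show "(\<integral>\<^sup>+ x. ennreal (norm (x ^ m)) \<partial>stopped_dist_law s t) < \<infinity>" .
qed simp

lemma integral_stopped_dist_law_eq_0:
  assumes "survival s" "survival t"
  shows "(\<integral>x. x \<partial>stopped_dist_law s t) = 0"
proof -
  have "(\<integral>x. x \<partial>stopped_dist_law s t) = (\<integral>x. x \<partial>distr (stopped_dist_law s t) borel uminus)"
    by (simp only: stopped_dist_law_uminus[OF assms])
  also have "\<dots> = (\<integral>x. - x \<partial>stopped_dist_law s t)"
    by (rule integral_distr) auto
  finally show ?thesis by simp
qed


section \<open>The optimal value\<close>

lemma payoff_run_payoff:
  assumes sets_\<xi>: "sets \<xi> = sets (W \<Otimes>\<^sub>M time_borel)"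
  shows "payoff run_payoff \<xi> =
    (\<Sum>n. ennreal ((1 / p_up) ^ n) * emeasure \<xi> ({\<omega> \<in> C0. run up_down n \<omega>} \<times> {2 * real n}))"
proof -
  have R: "{\<omega> \<in> C0. run up_down n \<omega>} \<times> {2 * real n} \<in> sets \<xi>" for n
    using sets_run[of up_down n] unfolding sets_\<xi>
    by (intro pair_measureI) (auto simp: sets_restrict_space image_iff)
  have "space \<xi> = C0 \<times> {0..}"
    using sets_eq_imp_space_eq[OF sets_\<xi>] by (simp add: space_pair_measure space_restrict_space)
  then have "payoff run_payoff \<xi> = (\<integral>\<^sup>+ x. (\<Sum>n. ennreal ((1 / p_up) ^ n) *
      indicator ({\<omega> \<in> C0. run up_down n \<omega>} \<times> {2 * real n}) x) \<partial>\<xi>)"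
    unfolding payoff_def by (intro nn_integral_cong) (auto simp: run_payoff_stop_map_eq_suminf)
  also have "\<dots> = (\<Sum>n. ennreal ((1 / p_up) ^ n) * emeasure \<xi> ({\<omega> \<in> C0. run up_down n \<omega>} \<times> {2 * real n}))"
    using R by (simp add: nn_integral_suminf nn_integral_cmult)
  finally show ?thesis .
qed

text \<open>Optional stopping for the payoff process at even times; \<open>r n\<close> is the mass of the run that
  survives time \<open>2n\<close>. A stop strictly between even times earns nothing, so it can only lose mass,
  and this is why the lookahead within a period does no harm.\<close>

lemma payoff_run_payoff_le_1:
  assumes "randomized_stopping_time W \<xi>"
  shows "payoff run_payoff \<xi> \<le> 1"
proof -
  obtain \<kappa> where \<kappa>: "\<kappa> \<in> W \<rightarrow>\<^sub>M subprob_algebra time_borel"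
    and slices: "\<And>X. X \<in> sets \<xi> \<Longrightarrow> emeasure \<xi> X = (\<integral>\<^sup>+ \<omega>. emeasure (\<kappa> \<omega>) (Pair \<omega> -` X) \<partial>W)"
    and adapted: "\<And>t. 0 \<le> t \<Longrightarrow> (\<lambda>\<omega>. emeasure (\<kappa> \<omega>) {0..t}) \<in> borel_measurable (raw_filtration t)"
    and sets_\<xi>: "sets \<xi> = sets (W \<Otimes>\<^sub>M time_borel)"
    using assms unfolding randomized_stopping_time_def by blast
  define A where "A n \<omega> = emeasure (\<kappa> \<omega>) {0..2 * real n}" for n \<omega>
  define e where "e n \<omega> = emeasure (\<kappa> \<omega>) {2 * real n}" for n \<omega>
  define c where "c n = (\<integral>\<^sup>+ \<omega>. (if run up_down n \<omega> then e n \<omega> else 0) \<partial>W)" for n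
  define r where "r n = (\<integral>\<^sup>+ \<omega>. (if run up_down n \<omega> then 1 - A n \<omega> else 0) \<partial>W)" for n
  define q where "q = 1 / p_up"
  have q: "0 < q" "q * p_up = 1" using p_up_pos by (auto simp: q_def)
  have sets_time: "{0..t} \<in> sets time_borel" "0 \<le> t \<Longrightarrow> {t} \<in> sets time_borel" for t :: real
    by (auto simp: sets_restrict_space_iff)
  have [measurable]: "e n \<in> borel_measurable W" for n
    unfolding e_def[abs_def] by (rule measurable_emeasure_kernel[OF \<kappa>]) (simp add: sets_time)
  have A_raw: "A n \<in> borel_measurable (raw_filtration (2 * real n))" for n
    unfolding A_def[abs_def] by (rule adapted) simp
  have [measurable]: "A n \<in> borel_measurable W" for n
    by (rule measurable_from_raw) (rule A_raw)
  have sets_\<kappa>: "sets (\<kappa> \<omega>) = sets time_borel" if "\<omega> \<in> C0" for \<omega>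
    using sets_kernel[OF \<kappa>] that by simp
  have A_le_1: "A n \<omega> \<le> 1" if "\<omega> \<in> C0" for n \<omega>
    unfolding A_def using subprob_space.subprob_emeasure_le_1[OF subprob_space_kernel[OF \<kappa>]] that by simp
  have e_0: "e 0 \<omega> = A 0 \<omega>" for \<omega> by (simp add: e_def A_def)
  \<comment> \<open>The inequality drops the mass stopped strictly inside the period.\<close>
  have e_Suc: "e (Suc n) \<omega> + A n \<omega> \<le> A (Suc n) \<omega>" if "\<omega> \<in> C0" for n \<omega>
  proof -
    have "e (Suc n) \<omega> + A n \<omega> = emeasure (\<kappa> \<omega>) ({2 * real (Suc n)} \<union> {0..2 * real n})"
      unfolding e_def A_def by (rule plus_emeasure) (auto simp: sets_\<kappa>[OF that] sets_time)
    also have "\<dots> \<le> A (Suc n) \<omega>"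
      unfolding A_def by (rule emeasure_mono) (auto simp: sets_\<kappa>[OF that] sets_time)
    finally show ?thesis .
  qed
  \<comment> \<open>Mass stopped at the end of the next period, or surviving it, was unstopped at
    time 2n. That mass is known at time 2n, so the next period contributes the independent factor
    \<open>p_up\<close>.\<close>
  have step: "c (Suc n) + r (Suc n) \<le> r n * ennreal p_up" for n
  proof -
    have "c (Suc n) + r (Suc n) =
        (\<integral>\<^sup>+ \<omega>. (if run up_down (Suc n) \<omega> then e (Suc n) \<omega> else 0)
          + (if run up_down (Suc n) \<omega> then 1 - A (Suc n) \<omega> else 0) \<partial>W)"
      unfolding c_def r_def by (rule nn_integral_add[symmetric]) measurable
    also have "\<dots> \<le> (\<integral>\<^sup>+ \<omega>. (if run up_down (Suc n) \<omega> then 1 - A n \<omega> else 0) \<partial>W)"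
    proof (rule nn_integral_mono)
      fix \<omega> assume "\<omega> \<in> space W"
      then have "e (Suc n) \<omega> + A n \<omega> \<le> A (Suc n) \<omega>" "A (Suc n) \<omega> \<le> 1"
        using e_Suc A_le_1 by auto
      then have "e (Suc n) \<omega> + A n \<omega> + (1 - A (Suc n) \<omega>) \<le> A (Suc n) \<omega> + (1 - A (Suc n) \<omega>)"
        by (intro add_right_mono)
      also have "\<dots> = 1"
        using \<open>A (Suc n) \<omega> \<le> 1\<close> by (rule add_diff_inverse_ennreal)
      finally have "e (Suc n) \<omega> + (1 - A (Suc n) \<omega>) + A n \<omega> \<le> 1"
        by (simp only: ac_simps)
      then have "e (Suc n) \<omega> + (1 - A (Suc n) \<omega>) \<le> 1 - A n \<omega>"
        by (simp add: ennreal_le_minus_iff)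
      then show "(if run up_down (Suc n) \<omega> then e (Suc n) \<omega> else 0)
          + (if run up_down (Suc n) \<omega> then 1 - A (Suc n) \<omega> else 0)
          \<le> (if run up_down (Suc n) \<omega> then 1 - A n \<omega> else 0)"
        by simp
    qed
    also have "\<dots> = r n * emeasure gauss2 up_down"
      unfolding r_def using A_raw[of n] by (intro nn_integral_run_Suc) auto
    finally show ?thesis by (simp add: gauss2.emeasure_eq_measure p_up_def)
  qed
  \<comment> \<open>The supermartingale invariant: payoff earned up to time 2N plus the current
    value of the surviving mass. Multiplying \<open>step\<close> by the next power of
    \<open>q\<close> cancels \<open>p_up\<close>.\<close>
  have bound: "(\<Sum>n<Suc N. ennreal (q ^ n) * c n) + ennreal (q ^ N) * r N \<le> 1" for N
  proof (induction N)
    case 0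
    have "c 0 + r 0 = (\<integral>\<^sup>+ \<omega>. e 0 \<omega> + (1 - A 0 \<omega>) \<partial>W)"
      unfolding c_def r_def by (simp add: nn_integral_add)
    also have "\<dots> = (\<integral>\<^sup>+ \<omega>. 1 \<partial>W)"
      using A_le_1 by (intro nn_integral_cong) (simp add: e_0 add_diff_inverse_ennreal)
    finally show ?case using emeasure_space_1 by simp
  next
    case (Suc N)
    have "ennreal (q ^ Suc N) * c (Suc N) + ennreal (q ^ Suc N) * r (Suc N)
        \<le> ennreal (q ^ Suc N) * (r N * ennreal p_up)"
      using mult_left_mono[OF step[of N]] by (simp add: distrib_left)
    also have "\<dots> = r N * (ennreal (q ^ Suc N) * ennreal p_up)"
      by (simp add: ac_simps)
    also have "ennreal (q ^ Suc N) * ennreal p_up = ennreal (q ^ N)"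
    proof -
      have "q ^ Suc N * p_up = q ^ N * (q * p_up)" by simp
      then show ?thesis
        using q p_up_pos by (subst ennreal_mult[symmetric]) simp_all
    qed
    finally have "ennreal (q ^ Suc N) * c (Suc N) + ennreal (q ^ Suc N) * r (Suc N) \<le> ennreal (q ^ N) * r N"
      by (simp add: mult.commute)
    then have "(\<Sum>n<Suc N. ennreal (q ^ n) * c n) +
        (ennreal (q ^ Suc N) * c (Suc N) + ennreal (q ^ Suc N) * r (Suc N)) \<le>
        (\<Sum>n<Suc N. ennreal (q ^ n) * c n) + ennreal (q ^ N) * r N"
      by (rule add_left_mono)
    also have "\<dots> \<le> 1" by (rule Suc.IH)
    finally show ?case by (simp add: add.assoc)
  qed
  have "emeasure \<xi> ({\<omega> \<in> C0. run up_down n \<omega>} \<times> {2 * real n}) = c n" for n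
  proof -
    have "{\<omega> \<in> C0. run up_down n \<omega>} \<times> {2 * real n} \<in> sets \<xi>"
      using sets_run[of up_down n] unfolding sets_\<xi> by (intro pair_measureI) (auto simp: sets_time)
    then have "emeasure \<xi> ({\<omega> \<in> C0. run up_down n \<omega>} \<times> {2 * real n})
        = (\<integral>\<^sup>+ \<omega>. emeasure (\<kappa> \<omega>) (Pair \<omega> -` ({\<omega> \<in> C0. run up_down n \<omega>} \<times> {2 * real n})) \<partial>W)"
      by (rule slices)
    also have "\<dots> = c n"
      unfolding c_def e_def by (intro nn_integral_cong) (auto simp: vimage_def)
    finally show ?thesis .
  qed
  then have "payoff run_payoff \<xi> = (\<Sum>n. ennreal (q ^ n) * c n)"
    by (simp add: payoff_run_payoff[OF sets_\<xi>] q_def)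
  also have "\<dots> \<le> 1"
  proof (rule suminf_le_const)
    fix N
    have "(\<Sum>n<N. ennreal (q ^ n) * c n) \<le> (\<Sum>n<Suc N. ennreal (q ^ n) * c n)" by simp
    also have "\<dots> \<le> (\<Sum>n<Suc N. ennreal (q ^ n) * c n) + ennreal (q ^ N) * r N" by simp
    also have "\<dots> \<le> 1" by (rule bound)
    finally show "(\<Sum>n<N. ennreal (q ^ n) * c n) \<le> 1" .
  qed simp
  finally show ?thesis .
qed

text \<open>A stop at time 2n + 2 earns only if the first n + 1 periods are up-down. There the
  weight is a constant \<open>d n\<close>, and the payoff cancels the probability of the run, so the
  total is the telescoping sum of \<open>d\<close>.\<close>

lemma payoff_mixed_stop:
  assumes s: "survival s" and t: "survival t" and l: "s \<longlonglongrightarrow> l"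
  shows "payoff run_payoff (mixed_stop s t) = ennreal (1 - l / 2)"
proof -
  \<comment> \<open>The extra term at n = 0 is the down-up branch: an up-down first period breaks
    its run at once, and its whole mass \<open>t 0\<close> = 1 stops at time 2, where it
    earns.\<close>
  define d where "d n = (s n - s (Suc n) + (if n = 0 then 1 else 0)) / 2" for n
  have d: "0 \<le> d n" for n using s by (auto simp: d_def survival_def less_imp_le)
  have up: "mixed_weight s t n \<omega> = d n" if "run up_down (Suc n) \<omega>" for n \<omega>
  proof -
    have run: "run up_down n \<omega>" "incr n \<omega> \<in> up_down" using that by (simp_all add: run_Suc)
    moreover have "run_weight down_up t n \<omega> = (if n = 0 then 1 else 0)"
    proof (cases n)
      case 0
      have "incr n \<omega> \<notin> down_up" using run(2) by (auto simp: up_down_def down_up_def)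
      then show ?thesis using 0 t by (simp add: run_weight_def survival_def)
    next
      case (Suc m)
      then show ?thesis using run_up_down_down_up[OF that, of n] by (auto simp: run_weight_def)
    qed
    ultimately show ?thesis by (simp add: mixed_weight_def d_def run_weight_def)
  qed
  have G [measurable]: "(\<lambda>x. ennreal (run_payoff (stop_map x))) \<in> borel_measurable (W \<Otimes>\<^sub>M time_borel)"
  proof -
    have [measurable]: "{\<omega> \<in> C0. run up_down n \<omega>} \<times> {2 * real n} \<in> sets (W \<Otimes>\<^sub>M time_borel)" for n
      using sets_run[of up_down n] by (intro pair_measureI) (auto simp: sets_restrict_space image_iff)
    have "(\<lambda>x. \<Sum>n. ennreal ((1 / p_up) ^ n) * indicator ({\<omega> \<in> C0. run up_down n \<omega>} \<times> {2 * real n}) x)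
        \<in> borel_measurable (W \<Otimes>\<^sub>M time_borel)"
      by measurable
    then show ?thesis
      by (rule measurable_cong[THEN iffD1, rotated])
        (auto simp: space_pair_measure run_payoff_stop_map_eq_suminf)
  qed
  have "payoff run_payoff (mixed_stop s t) = (\<Sum>n. \<integral>\<^sup>+ \<omega>. ennreal (mixed_weight s t n \<omega>) *
      ennreal (run_payoff (stop_map (\<omega>, 2 * real n + 2))) \<partial>W)"
    unfolding payoff_def by (rule nn_integral_stop_at_even) measurable
  also have "\<dots> = (\<Sum>n. ennreal (d n))"
  proof (rule suminf_cong)
    fix n
    have G_eq: "run_payoff (stop_map (\<omega>, 2 * real n + 2)) =
        (if run up_down (Suc n) \<omega> then (1 / p_up) ^ Suc n else 0)" for \<omega>
      using run_payoff_stop_map_even[of \<omega> "Suc n"] by (simp add: add.commute)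
    have "(\<integral>\<^sup>+ \<omega>. ennreal (mixed_weight s t n \<omega>) * ennreal (run_payoff (stop_map (\<omega>, 2 * real n + 2))) \<partial>W)
      = (\<integral>\<^sup>+ \<omega>. ennreal (d n * (1 / p_up) ^ Suc n) * indicator {\<omega> \<in> space W. run up_down (Suc n) \<omega>} \<omega> \<partial>W)"
      using d p_up_pos unfolding G_eq
      by (intro nn_integral_cong) (auto simp: up simp flip: ennreal_mult)
    also have "\<dots> = ennreal (d n * (1 / p_up) ^ Suc n) * ennreal (p_up ^ Suc n)"
      using sets_run[of up_down "Suc n"] emeasure_run[of up_down "Suc n"]
      by (simp add: nn_integral_cmult_indicator measure_up_down)
    also have "\<dots> = ennreal (d n)"
      using d p_up_pos by (subst ennreal_mult[symmetric]) (auto simp: power_divide)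
    finally show "(\<integral>\<^sup>+ \<omega>. ennreal (mixed_weight s t n \<omega>) *
      ennreal (run_payoff (stop_map (\<omega>, 2 * real n + 2))) \<partial>W) = ennreal (d n)" .
  qed
  also have "d sums (((s 0 - l) + 1) / 2)"
    unfolding d_def using sums_single[of 0 "\<lambda>_. 1 :: real"]
    by (intro sums_divide sums_add telescope_sums' l) simp
  then have "d sums (1 - l / 2)"
    using s by (simp add: survival_def diff_divide_distrib)
  then have "(\<Sum>n. ennreal (d n)) = ennreal (1 - l / 2)"
    using d by (subst suminf_ennreal2) (auto simp: sums_iff)
  finally show ?thesis .
qed

text \<open>Already before projection to stopped paths, a set is null iff it almost surely avoids
  every stop at which one of the runs is alive, a condition free of \<open>s\<close> and
  \<open>t\<close>. Exchanging \<open>s\<close> and \<open>t\<close> gives the converse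
  direction.\<close>

lemma absolutely_continuous_stopped_law:
  assumes s: "survival s" and t: "survival t"
  shows "absolutely_continuous (stopped_law (mixed_stop s t)) (stopped_law (mixed_stop t s))"
  unfolding stopped_law_def
proof (rule absolutely_continuous_distr)
  have emeasure_eq_0: "emeasure (mixed_stop u v) X = 0 \<longleftrightarrow>
      (\<forall>n. AE \<omega> in W. (\<not> run up_down n \<omega> \<and> \<not> run down_up n \<omega>) \<or> (\<omega>, 2 * real n + 2) \<notin> X)"
    if u: "survival u" and v: "survival v" and X: "X \<in> sets (W \<Otimes>\<^sub>M time_borel)" for u v X
  proof -
    have M: "(\<lambda>\<omega>. ennreal (mixed_weight u v n \<omega>) * indicator X (\<omega>, 2 * real n + 2)) \<in> borel_measurable W" for n
      by (intro borel_measurable_times_ennreal measurable_compose[OF _ borel_measurable_indicator[OF X]])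
        (auto intro!: measurable_Pair simp: space_restrict_space)
    have "emeasure (mixed_stop u v) X =
        (\<Sum>n. \<integral>\<^sup>+ \<omega>. ennreal (mixed_weight u v n \<omega>) * indicator X (\<omega>, 2 * real n + 2) \<partial>W)"
      using nn_integral_stop_at_even[OF measurable_mixed_weight, of "indicator X" "\<lambda>_. u" "\<lambda>_. v"] X by simp
    also have "\<dots> = 0 \<longleftrightarrow> (\<forall>n. (\<integral>\<^sup>+ \<omega>. ennreal (mixed_weight u v n \<omega>) * indicator X (\<omega>, 2 * real n + 2) \<partial>W) = 0)"
      by (subst suminf_eq_zero_iff) auto
    also have "\<dots> \<longleftrightarrow> (\<forall>n. AE \<omega> in W. (\<not> run up_down n \<omega> \<and> \<not> run down_up n \<omega>) \<or> (\<omega>, 2 * real n + 2) \<notin> X)"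
    proof -
      have "ennreal (mixed_weight u v n \<omega>) = 0 \<longleftrightarrow> \<not> run up_down n \<omega> \<and> \<not> run down_up n \<omega>" for n \<omega>
        using mixed_weight_nonneg[OF u v, of n \<omega>] mixed_weight_eq_0_iff[OF u v, of n \<omega>]
        by (auto simp: ennreal_eq_0_iff)
      then show ?thesis
        by (simp only: nn_integral_0_iff_AE[OF M] mult_eq_0_iff indicator_eq_0_iff)
    qed
    finally show ?thesis .
  qed
  show "absolutely_continuous (mixed_stop s t) (mixed_stop t s)"
    unfolding absolutely_continuous_def
    using emeasure_eq_0[OF s t] emeasure_eq_0[OF t s] by (auto simp: null_sets_def)
  show "stop_map \<in> space (mixed_stop s t) \<rightarrow> space stopped_borel"
    using stop_map_in_stopped_paths by auto
  interpret \<xi>: prob_space "mixed_stop t s"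
    using randomized_stopping_time_mixed_stop[OF t s] by (simp add: randomized_stopping_time_def)
  show "emeasure (mixed_stop t s) (space (mixed_stop t s)) \<noteq> 0"
    using \<xi>.emeasure_space_1 by simp
qed simp

end

section \<open>Choice of the survival sequences and conclusion\<close>

theorem proposition7p4:
  fixes W :: "path measure"
  assumes "wiener_measure W"
  shows "\<exists>(G :: path \<times> real \<Rightarrow> real) (\<nu> :: real measure) \<xi>1 \<xi>2.
    G \<in> borel_measurable stopped_borel \<and> (\<forall>x \<in> stopped_paths. 0 \<le> G x) \<and>
    prob_space \<nu> \<and> sets \<nu> = sets borel \<and>
    (\<forall>n::nat. integrable \<nu> (\<lambda>x. x ^ n)) \<and> (\<integral>x. x \<partial>\<nu>) = 0 \<and>
    optimal_value W \<nu> G < \<infinity> \<and>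
    \<xi>1 \<in> embeddings W \<nu> \<and> \<xi>2 \<in> embeddings W \<nu> \<and>
    absolutely_continuous (stopped_law \<xi>1) (stopped_law \<xi>2) \<and>
    absolutely_continuous (stopped_law \<xi>2) (stopped_law \<xi>1) \<and>
    payoff G \<xi>1 = optimal_value W \<nu> G \<and>
    payoff G \<xi>2 \<noteq> optimal_value W \<nu> G"
proof -
  interpret wiener_space W by unfold_locales (rule assms)
  \<comment> \<open>Both sequences start at 1 and decrease strictly; only the limits 0 and 1/2
    matter for the payoffs, which become 1 and 3/4 according to which sequence governs the up-down
    branch.\<close>
  define a b :: "nat \<Rightarrow> real" where "a n = (1 / 2) ^ n" and "b n = (1 + a n) / 2" for n
  have a: "survival a" and b: "survival b"
    by (auto simp: survival_def a_def b_def intro!: add_pos_pos)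
  have lim_a: "a \<longlonglongrightarrow> 0"
    unfolding a_def by (intro LIMSEQ_power_zero) simp
  have lim_b: "b \<longlonglongrightarrow> 1 / 2"
    using tendsto_divide[OF tendsto_add[OF tendsto_const lim_a] tendsto_const, of 2 1]
    by (simp add: b_def[abs_def])
  let ?\<nu> = "stopped_dist_law a b"
  have 1: "payoff run_payoff (mixed_stop a b) = 1"
    using payoff_mixed_stop[OF a b lim_a] by simp
  have 2: "payoff run_payoff (mixed_stop b a) = ennreal (3 / 4)"
    using payoff_mixed_stop[OF b a lim_b] by simp
  have in_1: "mixed_stop a b \<in> embeddings W ?\<nu>"
    using a b by (rule mixed_stop_in_embeddings)
  have in_2: "mixed_stop b a \<in> embeddings W ?\<nu>"
    \<comment> \<open>Exchanging the sequences keeps the embedded law, so both rules compete for the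
      same target.\<close>
    using mixed_stop_in_embeddings[OF b a] by (simp only: stopped_dist_law_commute[OF b a])
  have opt: "optimal_value W ?\<nu> run_payoff = 1"
    unfolding optimal_value_def
  proof (rule antisym)
    show "(SUP \<xi>\<in>embeddings W ?\<nu>. payoff run_payoff \<xi>) \<le> 1"
      by (rule SUP_least) (simp add: embeddings_def payoff_run_payoff_le_1)
    show "1 \<le> (SUP \<xi>\<in>embeddings W ?\<nu>. payoff run_payoff \<xi>)"
      using in_1 by (rule SUP_upper2) (simp add: 1)
  qed
  have "ennreal (3 / 4) \<noteq> 1"
    by (subst ennreal_1[symmetric], subst ennreal_inj) auto
  then show ?thesis
    using in_1 in_2 absolutely_continuous_stopped_law[OF a b] absolutely_continuous_stopped_law[OF b a]
      measurable_run_payoff run_payoff_nonneg prob_space_stopped_dist_law[OF a b]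
      integrable_stopped_dist_law_power[OF a b] integral_stopped_dist_law_eq_0[OF a b]
    by (intro exI[of _ run_payoff] exI[of _ ?\<nu>] exI[of _ "mixed_stop a b"] exI[of _ "mixed_stop b a"])
      (simp add: 1 2 opt)
qed

end
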